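(* Let $S$ be a finitely generated positive cancelative commutative semigroup, $E\subset S\setminus\{0\}$ a nonempty finite subset, and $A\subset S\setminus\{0\}$ a finite subset with $A\cap E=\emptyset$. Let $P=P_S=\sum_{m\in S}t^m\in\hat R=\mathbb{Z}[[S]]$. (1) For every subset $B\subset S$ with the property that whenever $b\in B$ and $n,n'\in S$ satisfy $b+n+n'\in B$, then $b+n\in B$ and $b+n'\in B$, the series $$P_{\mathcal{G}_B}=\frac{-\sum_{m\in S}\chi(B,m)\,t^m}{\prod_{e\in E}(1-t^e)\prod_{a\in A}(1-t^a)}$$ satisfies $$P_{\mathcal{G}_B}=\frac{N_B}{\prod_{e\in E}(1-t^e)},$$ and it does not depend on $A$. (2) $$P=P_{\mathcal{G}_Q}-\sum_{J\subset E,\ \#J\ge2}(-1)^{\#J}P_{\mathcal{G}_{D^J}}.$$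
   Context: Semigroups: a semigroup here is a set with an associative operation $+$ and a neutral element $0$. It is cancelative if $m+n=m'+n$ implies $m=m'$; positive if $m+n=0$ implies $m=n=0$; finitely generated if finitely many elements generate it under linear combinations with nonnegative integer coefficients. $S$ is viewed inside the abelian group $G(S)$ it generates (its group of differences); differences $m-n$ are taken in $G(S)$ (which may have torsion). Rings: $\hat R=\mathbb{Z}[[S]]$ is the ring of all formal sums $\sum_{m\in S}a_mt^m$, $a_m\in\mathbb{Z}$, with multiplication determined by $t^mt^n=t^{m+n}$ (well defined because each $m\in S$ can be written as $m=n+n'$ with $n,n'\in S$ in only finitely many ways). For $e\in S\setminus\{0\}$, $1-t^e$ is a unit in $\hat R$ with inverse $\sum_{i\ge0}t^{ie}$; fractions mean multiplication by the inverse of the denominator in $\hat R$. For $B\subset S$, $N_B=\sum_{m\in B}t^m\in\hat R$. Sets attached to $E$: for $J\subset E$ let $e_J=\sum_{e\in J}e$; $\mathrm{supp}(m)=\{e\in E\mid m-e\in S\}$; $Q=\{m\in S\mid m-e\notin S\text{ for all }e\in E\}$; for $J\subset E$ with $\#J\ge2$, $D^J=\{m\in S\mid J\subset\mathrm{supp}(m)\text{ and }m-e_J\notin S\}$. The sets $Q$ and $D^J$ have the property required of $B$ in (1), so that $P_{\mathcal{G}_Q}$ and $P_{\mathcal{G}_{D^J}}$ are defined. Colored graph data: for $I\subset A$ let $a_I=\sum_{a\in I}a$ (with $a_\emptyset=0$). Let $B\subset S$ have the property in (1). For $m\in S$, a relation for $m$ (with respect to $B$) of dimension $\ell$ is a subset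 $I\subset A$ with $\#I=\ell+1$ and $m-a_I\in B$; here $-1\le\ell\le\#A-1$. Let $r_\ell(B,m)$ be the number of relations of dimension $\ell$ for $m$, and let $C_\ell(\mathcal{G}_B,m)$ be the free $\mathbb{Z}$-module on them. Let $\partial_\ell:C_\ell(\mathcal{G}_B,m)\to C_{\ell-1}(\mathcal{G}_B,m)$ be the simplicial boundary of the full simplex $\mathcal{P}(A)$ of all subsets of $A$ followed by the projection $C_{\ell-1}(\mathcal{P}(A))\to C_{\ell-1}(\mathcal{G}_B,m)$ which kills the subsets that are not relations for $m$. The property of $B$ makes this a chain complex; with $h_\ell(B,m)$ the rank of its $\ell$-th homology, the Euler characteristic is $$\chi(B,m)=\sum_{\ell=-1}^{\#A-1}(-1)^\ell h_\ell(B,m)=\sum_{\ell=-1}^{\#A-1}(-1)^\ell r_\ell(B,m).$$ *)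

theory Defs
  imports "HOL-Algebra.Free_Abelian_Groups"
begin

section \<open>Finitely generated positive cancelative commutative semigroups\<close>

text \<open>
  The semigroup \<open>S\<close> is a type of the following class. The sum \<open>\<Sum>i<c g. g\<close> is the multiple
  \<open>c g\<close> times \<open>g\<close>.
\<close>

class fg_positive_cancel_semigroup = comm_monoid_add +
  assumes cancelative: "m + n = m' + n \<Longrightarrow> m = m'"
    and positive: "m + n = 0 \<Longrightarrow> m = 0 \<and> n = 0"
    and finitely_generated:
      "\<exists>G. finite G \<and> (\<forall>m. \<exists>c::'a \<Rightarrow> nat. m = (\<Sum>g\<in>G. \<Sum>i<c g. g))"
begin

lemma cancelative_left: "n + m = n + m' \<Longrightarrow> m = m'"
  using cancelative[of m n m'] by (simp add: add.commute)

lemma sum_eq_0_imp: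
  assumes "finite G" "(\<Sum>g\<in>G. h g) = 0" "g \<in> G"
  shows "h g = 0"
  using positive[of "h g" "sum h (G - {g})"] assms by (simp add: sum.remove)

end

section \<open>The group of differences\<close>

quotient_type (overloaded) 'a diff_group =
  "'a::fg_positive_cancel_semigroup \<times> 'a" / "\<lambda>(a, b) (c, d). a + d = c + b"
proof (rule equivpI)
  show "reflp (\<lambda>(a, b) (c, d). a + d = c + (b::'a))"
    by (auto simp: reflp_def)
  show "symp (\<lambda>(a, b) (c, d). a + d = c + (b::'a))"
    by (auto simp: symp_def)
  show "transp (\<lambda>(a, b) (c, d). a + d = c + (b::'a))"
  proof (rule transpI, clarsimp)
    fix a b c d e f :: 'a
    assume 1: "a + d = c + b" and 2: "c + f = e + d"
    have "(a + f) + d = (a + d) + f" by (simp add: ac_simps)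
    also have "\<dots> = (c + f) + b" by (simp add: 1 ac_simps)
    also have "\<dots> = (e + b) + d" by (simp add: 2 ac_simps)
    finally show "a + f = e + b" by (rule cancelative)
  qed
qed

instantiation diff_group :: (fg_positive_cancel_semigroup) ab_group_add
begin

lift_definition zero_diff_group :: "'a diff_group" is "(0, 0)" .

lift_definition plus_diff_group :: "'a diff_group \<Rightarrow> 'a diff_group \<Rightarrow> 'a diff_group"
  is "\<lambda>(a, b) (c, d). (a + c, b + d)"
proof clarsimp
  fix a b c d a' b' c' d' :: 'a
  assume 1: "a + d = c + b" and 2: "a' + d' = c' + b'"
  have "a + a' + (d + d') = (a + d) + (a' + d')" by (simp add: ac_simps)
  also have "\<dots> = c + c' + (b + b')" unfolding 1 2 by (simp add: ac_simps)
  finally show "a + a' + (d + d') = c + c' + (b + b')" .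
qed

lift_definition uminus_diff_group :: "'a diff_group \<Rightarrow> 'a diff_group"
  is "\<lambda>(a, b). (b, a)"
  by (auto simp: ac_simps)

definition minus_diff_group :: "'a diff_group \<Rightarrow> 'a diff_group \<Rightarrow> 'a diff_group"
  where "minus_diff_group x y = x + (- y)"

instance
proof
  fix x y z :: "'a diff_group"
  show "x + y + z = x + (y + z)" by transfer (auto simp: ac_simps)
  show "x + y = y + x" by transfer (auto simp: ac_simps)
  show "0 + x = x" by transfer auto
  show "- x + x = 0" by transfer (auto simp: ac_simps)
  show "x - y = x + - y" by (rule minus_diff_group_def)
qed

end

text \<open>The inclusion of \<open>S\<close> into its group of differences.\<close>

lift_definition diff_emb :: "'a::fg_positive_cancel_semigroup \<Rightarrow> 'a diff_group" is "\<lambda>m. (m, 0)" .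

lemma diff_emb_minus_in_iff:
  "diff_emb m - diff_emb n \<in> diff_emb ` B \<longleftrightarrow> (\<exists>b\<in>B. m = b + n)"
proof -
  have "diff_emb m - diff_emb n = diff_emb b \<longleftrightarrow> m = b + n" for b
    unfolding diff_eq_eq by transfer simp
  then show ?thesis by auto
qed


section \<open>Finiteness of the set of decompositions\<close>

definition decomps :: "'a::comm_monoid_add \<Rightarrow> ('a \<times> 'a) set"
  where "decomps m = {(n, n'). n + n' = m}"

lemma mem_decomps [simp]: "(n, n') \<in> decomps m \<longleftrightarrow> n + n' = m"
  by (simp add: decomps_def)

lemma nat_seq_mono_subseq:
  fixes f :: "nat \<Rightarrow> nat"
  shows "\<exists>r :: nat \<Rightarrow> nat. strict_mono r \<and> mono (f \<circ> r)"
proof -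
  define X where "X = {n. \<forall>k\<ge>n. f n \<le> f k}"
  have "\<exists>n\<ge>N. n \<in> X" for N
  proof -
    obtain n where n: "n \<ge> N" "\<And>k. k \<ge> N \<Longrightarrow> f n \<le> f k"
      using ex_has_least_nat[of "\<lambda>n. n \<ge> N" N f] by auto
    then have "n \<in> X" by (auto simp: X_def)
    with n(1) show ?thesis by auto
  qed
  then have "infinite X"
    by (metis finite_nat_set_iff_bounded not_less)
  then have "strict_mono (enumerate X)" "\<And>n. enumerate X n \<in> X"
    by (auto simp: strict_mono_enumerate enumerate_in_set)
  moreover from this have "mono (f \<circ> enumerate X)"
    by (auto simp: mono_def X_def strict_mono_less_eq)
  ultimately show ?thesis by blast
qed

lemma dickson_subseq:
  fixes u :: "nat \<Rightarrow> 'b \<Rightarrow> nat"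
  assumes "finite G"
  shows "\<exists>r :: nat \<Rightarrow> nat. strict_mono r \<and> (\<forall>g\<in>G. mono (\<lambda>n. u (r n) g))"
  using assms
proof (induction G)
  case empty
  show ?case by (rule exI[of _ "\<lambda>n. n"]) (simp add: strict_mono_def)
next
  case (insert x G)
  then obtain r :: "nat \<Rightarrow> nat" where r: "strict_mono r" "\<forall>g\<in>G. mono (\<lambda>n. u (r n) g)" by auto
  obtain s :: "nat \<Rightarrow> nat" where s: "strict_mono s" "mono ((\<lambda>n. u (r n) x) \<circ> s)"
    using nat_seq_mono_subseq by blast
  have "strict_mono (r \<circ> s)" using r(1) s(1) by (simp add: strict_mono_def)
  moreover have "mono (\<lambda>n. u ((r \<circ> s) n) g)" if "g \<in> insert x G" for g
    using that r(2) s strict_mono_mono[OF s(1)] by (auto simp: mono_def)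
  ultimately show ?case by blast
qed

lemma finite_decomps: "finite (decomps (m::'a::fg_positive_cancel_semigroup))"
proof -
  obtain G0 :: "'a set" where G0: "finite G0" "\<And>m. \<exists>c::'a \<Rightarrow> nat. m = (\<Sum>g\<in>G0. \<Sum>i<c g. g)"
    using finitely_generated by blast
  define G where "G = G0 - {0}"
  define \<phi> where "\<phi> c = (\<Sum>g\<in>G. \<Sum>i<c g. g)" for c :: "'a \<Rightarrow> nat"
  have fin: "finite G" using G0 by (simp add: G_def)
  have gen: "\<exists>c. (\<forall>g. g \<notin> G \<longrightarrow> c g = 0) \<and> m = \<phi> c" for m
  proof -
    obtain c :: "'a \<Rightarrow> nat" where c: "m = (\<Sum>g\<in>G0. \<Sum>i<c g. g)" using G0(2) by blast
    have "m = (\<Sum>g\<in>G. \<Sum>i<c g. g)"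
      unfolding c G_def by (rule sum.mono_neutral_right) (use G0 in auto)
    also have "\<dots> = \<phi> (\<lambda>g. if g \<in> G then c g else 0)"
      by (auto simp: \<phi>_def intro!: sum.cong)
    finally show ?thesis by (intro exI[of _ "\<lambda>g. if g \<in> G then c g else 0"]) auto
  qed
  have mult_add: "(\<Sum>i<k + l. g) = (\<Sum>i<k. g) + (\<Sum>i<l. (g::'a))" for k l :: nat and g
    by (induction l) (auto simp: ac_simps)
  have \<phi>_add: "\<phi> (\<lambda>g. c g + d g) = \<phi> c + \<phi> d" for c d
    by (simp add: \<phi>_def mult_add sum.distrib)
  define K where "K = {c. (\<forall>g. g \<notin> G \<longrightarrow> c g = 0) \<and> \<phi> c = m}"
  have "finite K"
  proof (rule ccontr)
    assume "infinite K"
    then obtain u :: "nat \<Rightarrow> 'a \<Rightarrow> nat" where u: "inj u" "range u \<subseteq> K"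
      using infinite_countable_subset by blast
    obtain r :: "nat \<Rightarrow> nat" where r: "strict_mono r" "\<forall>g\<in>G. mono (\<lambda>n. u (r n) g)"
      using dickson_subseq[OF fin] by blast
    define d where "d g = u (r 1) g - u (r 0) g" for g
    have K: "u (r n) \<in> K" for n using u(2) by auto
    have le: "u (r 0) g \<le> u (r 1) g" for g
    proof (cases "g \<in> G")
      case True
      with r(2) show ?thesis by (auto simp: mono_def)
    next
      case False
      with K[of 0] show ?thesis by (auto simp: K_def)
    qed
    then have eq: "u (r 1) = (\<lambda>g. u (r 0) g + d g)" by (auto simp: d_def)
    have "m + \<phi> d = m + 0"
      using K[of 0] K[of 1] \<phi>_add[of "u (r 0)" d] eq by (simp add: K_def)
    then have "\<phi> d = 0" by (rule cancelative_left)
    then have "(\<Sum>i<d g. g) = 0" if "g \<in> G" for g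
      using sum_eq_0_imp[OF fin _ that, of "\<lambda>g. \<Sum>i<d g. g"] by (simp add: \<phi>_def)
    then have "d g = 0" if "g \<in> G" for g
      using that sum_eq_0_imp[of "{..<d g}" "\<lambda>_. g" 0] by (auto simp: G_def)
    moreover have "d g = 0" if "g \<notin> G" for g
      using that K[of 1] by (auto simp: d_def K_def)
    ultimately have "u (r 1) = u (r 0)" using eq by (auto simp: fun_eq_iff)
    with u(1) have "r 1 = r 0" by (auto dest: injD)
    with r(1) show False using strict_monoD[OF r(1), of 0 1] by simp
  qed
  have fin_below: "finite {c. \<forall>g. c g \<le> k g}" if "k \<in> K" for k
  proof (rule finite_subset)
    show "{c. \<forall>g. c g \<le> k g} \<subseteq>
        {f. \<forall>x. (x \<in> G \<longrightarrow> f x \<in> {..Max (k ` G)}) \<and> (x \<notin> G \<longrightarrow> f x = 0)}"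
    proof (clarsimp, intro conjI impI)
      fix c g assume c: "\<forall>g. c g \<le> k g"
      { assume "g \<in> G"
        then have "k g \<le> Max (k ` G)" using fin by auto
        with c show "c g \<le> Max (k ` G)" using order_trans by blast }
      { assume "g \<notin> G"
        with that have "k g = 0" by (auto simp: K_def)
        with c show "c g = 0" by (metis le_zero_eq) }
    qed
    show "finite {f. \<forall>x. (x \<in> G \<longrightarrow> f x \<in> {..Max (k ` G)}) \<and> (x \<notin> G \<longrightarrow> f x = 0)}"
      using fin by (intro finite_set_of_finite_funs) auto
  qed
  define D where "D = (\<Union>k\<in>K. {c. \<forall>g. c g \<le> k g} \<times> {c. \<forall>g. c g \<le> k g})"
  have "decomps m \<subseteq> (\<lambda>(c, d). (\<phi> c, \<phi> d)) ` D"
  proof clarsimp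
    fix n n' assume *: "m = n + n'"
    obtain c d where c: "\<forall>g. g \<notin> G \<longrightarrow> c g = 0" "n = \<phi> c"
      and d: "\<forall>g. g \<notin> G \<longrightarrow> d g = 0" "n' = \<phi> d"
      using gen by metis
    have "(\<lambda>g. c g + d g) \<in> K" using * c d by (auto simp: K_def \<phi>_add)
    then have "(c, d) \<in> D"
      unfolding D_def by (intro UN_I[of "\<lambda>g. c g + d g"]) auto
    with c d show "(n, n') \<in> (\<lambda>(c, d). (\<phi> c, \<phi> d)) ` D" by force
  qed
  moreover have "finite D"
    using \<open>finite K\<close> fin_below by (auto simp: D_def)
  ultimately show ?thesis by (meson finite_imageI finite_subset)
qed


section \<open>The ring of formal power series over \<open>S\<close>\<close>

text \<open>\<open>Series a\<close> is the formal sum of all \<open>a m t^m\<close>.\<close>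

typedef 'a mseries = "UNIV :: ('a \<Rightarrow> int) set"
  morphisms coeff Series ..

lemma coeff_Series [simp]: "coeff (Series a) m = a m"
  by (simp add: Series_inverse)

lemma mseries_eqI: "(\<And>m. coeff f m = coeff g m) \<Longrightarrow> f = g"
  using coeff_inject by fastforce

instantiation mseries :: (fg_positive_cancel_semigroup) comm_ring_1
begin

definition "0 = Series (\<lambda>m. 0)"
definition "1 = Series (\<lambda>m. if m = 0 then 1 else 0)"
definition "f + g = Series (\<lambda>m. coeff f m + coeff g m)"
definition "- f = Series (\<lambda>m. - coeff f m)"
definition "f - g = Series (\<lambda>m. coeff f m - coeff g m)"
definition "f * g = Series (\<lambda>m. \<Sum>(n, n')\<in>decomps m. coeff f n * coeff g n')"

instance
proof
  fix f g h :: "'a mseries"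
  note defs = zero_mseries_def one_mseries_def plus_mseries_def uminus_mseries_def
    minus_mseries_def times_mseries_def
  show "f + g + h = f + (g + h)" "f + g = g + f" "0 + f = f" "- f + f = 0" "f - g = f + - g"
    by (auto simp: defs intro!: mseries_eqI)
  show "(0::'a mseries) \<noteq> 1"
    by (auto simp: defs dest!: arg_cong[where f = "\<lambda>f. coeff f 0"])
  show "(f + g) * h = f * h + g * h"
    by (auto simp: defs case_prod_unfold algebra_simps sum.distrib intro!: mseries_eqI)
  show "f * g = g * f"
  proof (rule mseries_eqI)
    fix m
    show "coeff (f * g) m = coeff (g * f) m"
      unfolding times_mseries_def coeff_Series
      by (rule sum.reindex_bij_witness[where i = prod.swap and j = prod.swap])
         (auto simp: ac_simps)
  qed
  show "1 * f = f"
  proof (rule mseries_eqI)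
    fix m
    have "coeff (1 * f) m =
        (\<Sum>(n, n')\<in>decomps m. (if n = 0 then 1 else 0 :: int) * coeff f n')"
      by (simp add: defs)
    also have "\<dots> = (\<Sum>(n, n')\<in>{(0 :: 'a, m)}. (if n = 0 then 1 else 0 :: int) * coeff f n')"
      by (rule sum.mono_neutral_right[OF finite_decomps]) (auto split: if_splits)
    finally show "coeff (1 * f) m = coeff f m" by simp
  qed
  show "f * g * h = f * (g * h)"
  proof (rule mseries_eqI)
    fix m
    have "coeff (f * g * h) m =
        (\<Sum>(x, k)\<in>decomps m. \<Sum>(i, j)\<in>decomps x. coeff f i * coeff g j * coeff h k)"
      by (auto simp: times_mseries_def sum_distrib_right case_prod_unfold)
    also have "\<dots> = (\<Sum>(p, q)\<in>(SIGMA p:decomps m. decomps (fst p)).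
        coeff f (fst q) * coeff g (snd q) * coeff h (snd p))"
      by (subst sum.Sigma[symmetric]) (auto simp: finite_decomps case_prod_unfold)
    also have "\<dots> = (\<Sum>(p, q)\<in>(SIGMA p:decomps m. decomps (snd p)).
        coeff f (fst p) * coeff g (fst q) * coeff h (snd q))"
      by (rule sum.reindex_bij_witness
          [where i = "\<lambda>((i, y), (j, k)). ((i + j, k), (i, j))"
             and j = "\<lambda>((x, k), (i, j)). ((i, j + k), (j, k))"])
         (auto simp: add.assoc)
    also have "\<dots> = (\<Sum>(i, y)\<in>decomps m. \<Sum>(j, k)\<in>decomps y. coeff f i * coeff g j * coeff h k)"
      by (subst sum.Sigma[symmetric]) (auto simp: finite_decomps case_prod_unfold)
    also have "\<dots> = coeff (f * (g * h)) m"
      by (auto simp: times_mseries_def sum_distrib_left case_prod_unfold mult.assoc)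
    finally show "coeff (f * g * h) m = coeff (f * (g * h)) m" .
  qed
qed

end

text \<open>
  Fractions of series are products with the inverse of the denominator; the value for
  a denominator which is not a unit is immaterial.
\<close>

instantiation mseries :: (fg_positive_cancel_semigroup) inverse
begin

definition inverse_mseries :: "'a mseries \<Rightarrow> 'a mseries"
  where "inverse_mseries f = (if f dvd 1 then THE g. f * g = 1 else 0)"

definition divide_mseries :: "'a mseries \<Rightarrow> 'a mseries \<Rightarrow> 'a mseries"
  where "divide_mseries f g = f * inverse g"

instance ..

end

lemma mseries_mult_inverse:
  fixes f :: "'a::fg_positive_cancel_semigroup mseries"
  assumes "f dvd 1"
  shows "f * inverse f = 1"
proof -
  from assms obtain g where g: "f * g = 1" by (metis dvd_def)
  have "g' = g" if "f * g' = 1" for g'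
    using that g by (metis mult.assoc mult.commute mult_1)
  with g have "\<exists>!g. f * g = 1" by blast
  from theI'[OF this] assms show ?thesis by (simp add: inverse_mseries_def)
qed

definition tpow :: "'a \<Rightarrow> 'a mseries"
  where "tpow m = Series (\<lambda>n. if n = m then 1 else 0)"

definition Nser :: "'a set \<Rightarrow> 'a mseries"
  where "Nser B = Series (\<lambda>m. if m \<in> B then 1 else 0)"


section \<open>Rank of an abelian group\<close>

text \<open>
  The maximal number of elements that are linearly independent over the integers
  (for a multiplicatively written group). All groups considered below are finitely generated,
  so that the supremum is a maximum.
\<close>

definition int_independent :: "('b, 'c) monoid_scheme \<Rightarrow> 'b set \<Rightarrow> bool"
  where "int_independent G T \<longleftrightarrow> T \<subseteq> carrier G \<and> finite T \<and>
    (\<forall>c::'b \<Rightarrow> int. finprod G (\<lambda>x. x [^]\<^bsub>G\<^esub> c x) T = \<one>\<^bsub>G\<^esub> \<longrightarrow> (\<forall>x\<in>T. c x = 0))"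

definition abelian_rank :: "('b, 'c) monoid_scheme \<Rightarrow> nat"
  where "abelian_rank G = Sup {card T | T. int_independent G T}"


section \<open>The colored graph data\<close>

definition relations :: "'a::fg_positive_cancel_semigroup set \<Rightarrow> 'a set \<Rightarrow> 'a \<Rightarrow> int \<Rightarrow> 'a set set"
  where "relations A B m l = {I. I \<subseteq> A \<and> int (card I) = l + 1 \<and>
    diff_emb m - diff_emb (\<Sum>a\<in>I. a) \<in> diff_emb ` B}"

definition chain_gp ::
    "'a::fg_positive_cancel_semigroup set \<Rightarrow> 'a set \<Rightarrow> 'a \<Rightarrow> int \<Rightarrow> ('a set \<Rightarrow>\<^sub>0 int) monoid"
  where "chain_gp A B m l = free_Abelian_group (relations A B m l)"

text \<open>
  The vertices of the full simplex on the finite set \<open>A\<close> are ordered by the enumeration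
  \<open>to_nat_on A\<close>; \<open>i\<close> has position \<open>card {j \<in> I. \<dots>}\<close> in \<open>I\<close>, counted from \<open>0\<close>. The empty set
  is the simplex of dimension \<open>-1\<close>.
\<close>

definition simplex_boundary :: "'a set \<Rightarrow> ('a set \<Rightarrow>\<^sub>0 int) \<Rightarrow> ('a set \<Rightarrow>\<^sub>0 int)"
  where "simplex_boundary A = frag_extend (\<lambda>I. \<Sum>i\<in>I.
    frag_cmul ((-1) ^ card {j \<in> I. to_nat_on A j < to_nat_on A i}) (frag_of (I - {i})))"

definition project_onto :: "'b set \<Rightarrow> ('b \<Rightarrow>\<^sub>0 int) \<Rightarrow> ('b \<Rightarrow>\<^sub>0 int)"
  where "project_onto R = frag_extend (\<lambda>I. if I \<in> R then frag_of I else 0)"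

definition boundary ::
    "'a::fg_positive_cancel_semigroup set \<Rightarrow> 'a set \<Rightarrow> 'a \<Rightarrow> int \<Rightarrow>
      ('a set \<Rightarrow>\<^sub>0 int) \<Rightarrow> ('a set \<Rightarrow>\<^sub>0 int)"
  where "boundary A B m l c = project_onto (relations A B m (l - 1)) (simplex_boundary A c)"

definition homology_gp ::
    "'a::fg_positive_cancel_semigroup set \<Rightarrow> 'a set \<Rightarrow> 'a \<Rightarrow> int \<Rightarrow> ('a set \<Rightarrow>\<^sub>0 int) set monoid"
  where "homology_gp A B m l =
    subgroup_generated (chain_gp A B m l)
      (kernel (chain_gp A B m l) (chain_gp A B m (l - 1)) (boundary A B m l))
    Mod (boundary A B m (l + 1) ` carrier (chain_gp A B m (l + 1)))"

definition euler_char :: "'a::fg_positive_cancel_semigroup set \<Rightarrow> 'a set \<Rightarrow> 'a \<Rightarrow> int"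
  where "euler_char A B m =
    (\<Sum>l = -1..int (card A) - 1. (-1) ^ nat \<bar>l\<bar> * int (abelian_rank (homology_gp A B m l)))"

definition PG :: "'a::fg_positive_cancel_semigroup set \<Rightarrow> 'a set \<Rightarrow> 'a set \<Rightarrow> 'a mseries"
  where "PG E A B =
    - Series (\<lambda>m. euler_char A B m) / ((\<Prod>e\<in>E. 1 - tpow e) * (\<Prod>a\<in>A. 1 - tpow a))"


section \<open>The sets attached to \<open>E\<close>\<close>

definition supp :: "'a::fg_positive_cancel_semigroup set \<Rightarrow> 'a \<Rightarrow> 'a set"
  where "supp E m = {e \<in> E. diff_emb m - diff_emb e \<in> range diff_emb}"

definition Qset :: "'a::fg_positive_cancel_semigroup set \<Rightarrow> 'a set"
  where "Qset E = {m. \<forall>e\<in>E. diff_emb m - diff_emb e \<notin> range diff_emb}"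

definition Dset :: "'a::fg_positive_cancel_semigroup set \<Rightarrow> 'a set \<Rightarrow> 'a set"
  where "Dset E J = {m. J \<subseteq> supp E m \<and>
    diff_emb m - diff_emb (\<Sum>e\<in>J. e) \<notin> range diff_emb}"

end

theory Submission
  imports Defs
begin

text \<open>
  The hypothesis on \<open>B\<close> makes the projected simplicial boundary square to zero, so the Euler
  characteristic may be computed from the ranks of the chain groups. It thus equals
  \<open>- \<Sum>I\<subseteq>A. (-1)^#I\<close>, restricted to the \<open>I\<close> with \<open>m - a\<^sub>I \<in> B\<close>, which is minus the coefficient of \<open>t^m\<close> in
  \<open>N\<^sub>B \<Prod>a\<in>A. (1 - t^a)\<close>. Cancelling the factors belonging to \<open>A\<close> gives (1).

  For (2), multiply by \<open>\<Prod>e\<in>E. (1 - t^e)\<close>. The coefficient of \<open>t^m\<close> on the left is the sum of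
  \<open>(-1)^#J\<close> over the \<open>J\<close> with \<open>m - e\<^sub>J \<in> S\<close>. These are the \<open>J \<subseteq> supp m\<close> with \<open>m \<notin> D\<^sup>J\<close>, and the sum over
  all \<open>J \<subseteq> supp m\<close> vanishes unless \<open>supp m\<close> is empty, that is, unless \<open>m \<in> Q\<close>.
\<close>

section \<open>Power series\<close>

lemmas mseries_defs = zero_mseries_def one_mseries_def plus_mseries_def uminus_mseries_def
  minus_mseries_def times_mseries_def

lemma coeff_0 [simp]: "coeff 0 m = 0"
  and coeff_1: "coeff 1 m = (if m = 0 then 1 else 0)"
  and coeff_add [simp]: "coeff (f + g) m = coeff f m + coeff g m"
  and coeff_uminus [simp]: "coeff (- f) m = - coeff f m"
  and coeff_diff [simp]: "coeff (f - g) m = coeff f m - coeff g m"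
  by (simp_all add: mseries_defs)

lemma coeff_sum: "coeff (sum f I) m = (\<Sum>i\<in>I. coeff (f i) m)"
  by (induction I rule: infinite_finite_induct) simp_all

lemma coeff_minus_one_power_mult: "coeff ((-1) ^ k * f) m = (-1) ^ k * coeff f m"
  by (cases "even k") simp_all

lemma coeff_Nser: "coeff (Nser B) m = (if m \<in> B then 1 else 0)"
  by (simp add: Nser_def)

text \<open>By cancelation, \<open>(n, k)\<close> is the only decomposition of \<open>n + k\<close>
  with first component \<open>n\<close>.\<close>

lemma coeff_tpow_mult:
  "coeff (tpow n * f) (n + k) = coeff f (k::'a::fg_positive_cancel_semigroup)"
proof -
  have "coeff (tpow n * f) (n + k) =
      (\<Sum>(i, j)\<in>decomps (n + k). (if i = n then 1 else 0) * coeff f j)"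
    by (simp add: times_mseries_def tpow_def)
  also have "\<dots> = (\<Sum>(i, j)\<in>{(n, k)}. (if i = n then 1 else 0) * coeff f j)"
    by (rule sum.mono_neutral_right[OF finite_decomps])
      (auto split: if_splits dest: cancelative_left)
  finally show ?thesis by simp
qed

lemma coeff_tpow_mult_eq_0:
  assumes "\<And>k. m \<noteq> n + k"
  shows "coeff (tpow n * f) m = 0"
  using assms unfolding times_mseries_def tpow_def coeff_Series by (intro sum.neutral) fastforce

text \<open>Multiplication by \<open>tpow n\<close> translates \<open>B\<close> by \<open>n\<close>.
  The condition is m - n \<in> B spelled out in S, a form that \<open>relations\<close>,
  \<open>supp\<close> and \<open>Dset\<close> take as well once differences are resolved.\<close>

lemma coeff_tpow_mult_Nser:
  "coeff (tpow n * Nser B) m = (if \<exists>b\<in>B. m = b + n then 1 else 0)"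
proof (cases "\<exists>k. m = n + k")
  case True
  then obtain k where "m = n + k" ..
  moreover from this have "(\<exists>b\<in>B. m = b + n) \<longleftrightarrow> k \<in> B"
    by (metis add.commute cancelative)
  ultimately show ?thesis by (simp add: coeff_tpow_mult coeff_Nser)
next
  case False
  then show ?thesis
    by (subst coeff_tpow_mult_eq_0) (auto simp: add.commute)
qed

lemma tpow_0: "tpow 0 = 1"
  by (rule mseries_eqI) (simp add: tpow_def coeff_1)

lemma tpow_add: "tpow (m + n) = tpow m * tpow n"
proof -
  have "coeff (tpow m * tpow n) k = coeff (tpow (m + n)) k" for k
  proof (cases "\<exists>l. k = m + l")
    case True
    then obtain l where l: "k = m + l" ..
    have "coeff (tpow m * tpow n) k = coeff (tpow n) l" by (simp add: l coeff_tpow_mult)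
    then show ?thesis by (auto simp: l tpow_def dest: cancelative_left)
  next
    case False
    then have "coeff (tpow m * tpow n) k = 0" by (intro coeff_tpow_mult_eq_0) auto
    with False show ?thesis by (auto simp: tpow_def)
  qed
  then show ?thesis by (metis mseries_eqI)
qed

lemma tpow_sum: "tpow (sum f I) = (\<Prod>i\<in>I. tpow (f i))"
  by (induction I rule: infinite_finite_induct) (simp_all add: tpow_0 tpow_add)

text \<open>Expanding the product gives one signed monomial for each subset. The formula serves
  twice: for \<open>A\<close> and \<open>B\<close> in the numerator of \<open>PG\<close>, and for
  \<open>E\<close> and all of S in the decomposition of P.\<close>

lemma coeff_prod_one_minus_tpow_mult_Nser:
  assumes "finite A"
  shows "coeff ((\<Prod>a\<in>A. 1 - tpow a) * Nser B) m =
    (\<Sum>I\<in>Pow A. (-1) ^ card I * (if \<exists>b\<in>B. m = b + (\<Sum>a\<in>I. a) then 1 else 0))"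
proof -
  have "(\<Prod>a\<in>A. 1 - tpow a) * Nser B =
      (\<Sum>I\<in>Pow A. (-1) ^ card I * (tpow (\<Sum>a\<in>I. a) * Nser B))"
    using assms by (simp add: prod_diff_conv_sum sum_distrib_right tpow_sum mult.assoc)
  then show ?thesis
    by (simp add: coeff_sum coeff_minus_one_power_mult coeff_tpow_mult_Nser)
qed

text \<open>The inverse is the geometric series, encoded as the indicator series of the set of
  multiples of \<open>e\<close>. These multiples are pairwise distinct because S is positive and
  cancelative and \<open>e\<close> is nonzero.\<close>

lemma one_minus_tpow_dvd_1:
  assumes "e \<noteq> (0::'a::fg_positive_cancel_semigroup)"
  shows "1 - tpow e dvd 1"
proof -
  define multiples where "multiples = range (\<lambda>i::nat. \<Sum>j<i. e)"
  define geo where "geo = Nser multiples"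
  have mem: "e + k \<in> multiples \<longleftrightarrow> k \<in> multiples" for k
  proof
    assume "e + k \<in> multiples"
    then obtain i :: nat where i: "e + k = (\<Sum>j<i. e)" by (auto simp: multiples_def)
    \<comment> \<open>\<open>i = 0\<close> would give e + k = 0, and then e = 0 by
      positivity.\<close>
    with assms obtain i' where "i = Suc i'"
      by (cases i) (auto dest: positive)
    with i have "e + k = e + (\<Sum>j<i'. e)" by (simp add: add.commute)
    then have "k = (\<Sum>j<i'. e)" by (rule cancelative_left)
    then show "k \<in> multiples" by (simp add: multiples_def)
  next
    assume "k \<in> multiples"
    then obtain i :: nat where "k = (\<Sum>j<i. e)" by (auto simp: multiples_def)
    then have "e + k = (\<Sum>j<Suc i. e)" by (simp add: add.commute)
    then show "e + k \<in> multiples" unfolding multiples_def by blast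
  qed
  have "coeff ((1 - tpow e) * geo) m = coeff 1 m" for m
  proof (cases "\<exists>k. m = e + k")
    case True
    then obtain k where "m = e + k" ..
    with assms mem show ?thesis
      by (auto simp: left_diff_distrib coeff_tpow_mult geo_def coeff_Nser coeff_1 dest: positive)
  next
    case False
    \<comment> \<open>Every multiple of \<open>e\<close> other than 0 has the form e + k.\<close>
    have "m \<in> multiples \<longleftrightarrow> m = 0"
    proof
      assume "m \<in> multiples"
      then obtain i :: nat where i: "m = (\<Sum>j<i. e)" by (auto simp: multiples_def)
      with False show "m = 0"
        by (cases i) (auto simp: add.commute)
    next
      assume "m = 0"
      then have "m = (\<Sum>j<(0::nat). e)" by simp
      then show "m \<in> multiples" unfolding multiples_def by blast
    qed
    with False show ?thesis
      by (simp add: left_diff_distrib coeff_tpow_mult_eq_0 geo_def coeff_Nser coeff_1)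
  qed
  then have "(1 - tpow e) * geo = 1" by (rule mseries_eqI)
  then show ?thesis by (metis dvdI)
qed

lemma prod_one_minus_tpow_dvd_1:
  assumes "0 \<notin> (E::'a::fg_positive_cancel_semigroup set)"
  shows "(\<Prod>e\<in>E. 1 - tpow e) dvd 1"
  using assms
proof (induction E rule: infinite_finite_induct)
  case (insert e E)
  then have "(1 - tpow e) * (\<Prod>e\<in>E. 1 - tpow e) dvd 1 * 1"
    by (intro mult_dvd_mono one_minus_tpow_dvd_1) auto
  with insert show ?case by simp
qed auto

lemma mseries_divide_eq_iff:
  fixes f g h :: "'a::fg_positive_cancel_semigroup mseries"
  assumes "g dvd 1"
  shows "f / g = h \<longleftrightarrow> f = h * g"
proof -
  note inv = mseries_mult_inverse[OF assms]
  have "h * g * inverse g = h" "f * inverse g * g = f"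
    using inv by (simp_all add: mult.assoc mult.commute[of "inverse g"])
  then show ?thesis unfolding divide_mseries_def by metis
qed


section \<open>Ranks of subquotients of free abelian groups\<close>

definition int_submodule :: "('b \<Rightarrow>\<^sub>0 int) set \<Rightarrow> bool"
  where "int_submodule M \<longleftrightarrow> 0 \<in> M \<and> (\<forall>x\<in>M. \<forall>y\<in>M. x - y \<in> M)"

lemma frag_cmul_diff_right: "frag_cmul k (x - y) = frag_cmul k x - frag_cmul k y"
  by (rule poly_mapping_eqI) (simp add: lookup_minus right_diff_distrib)

lemma int_submodule_0: "int_submodule M \<Longrightarrow> 0 \<in> M"
  and int_submodule_diff: "int_submodule M \<Longrightarrow> x \<in> M \<Longrightarrow> y \<in> M \<Longrightarrow> x - y \<in> M"
  by (auto simp: int_submodule_def)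

lemma int_submodule_uminus: "int_submodule M \<Longrightarrow> x \<in> M \<Longrightarrow> - x \<in> M"
  using int_submodule_diff[of M 0 x] int_submodule_0[of M] by simp

lemma int_submodule_add: "int_submodule M \<Longrightarrow> x \<in> M \<Longrightarrow> y \<in> M \<Longrightarrow> x + y \<in> M"
  using int_submodule_diff[of M x "- y"] int_submodule_uminus[of M y] by simp

lemma int_submodule_cmul: "int_submodule M \<Longrightarrow> x \<in> M \<Longrightarrow> frag_cmul k x \<in> M"
  by (rule frag_closure_minus_cmul) (auto simp: int_submodule_def)

lemma int_submodule_sum: "int_submodule M \<Longrightarrow> (\<And>i. i \<in> I \<Longrightarrow> f i \<in> M) \<Longrightarrow> sum f I \<in> M"
  by (induction I rule: infinite_finite_induct) (auto simp: int_submodule_0 int_submodule_add)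

abbreviation int_comb :: "(('b \<Rightarrow>\<^sub>0 int) \<Rightarrow> int) \<Rightarrow> ('b \<Rightarrow>\<^sub>0 int) set \<Rightarrow> ('b \<Rightarrow>\<^sub>0 int)"
  where "int_comb c X \<equiv> (\<Sum>x\<in>X. frag_cmul (c x) x)"

text \<open>For a subgroup \<open>L\<close>, this says that the elements of \<open>X\<close> have
  distinct classes in the quotient by \<open>L\<close> and that these classes are independent over
  the integers. Working with representatives keeps the rank computations inside the free abelian
  group; \<open>L = {0}\<close> is the absolute case.\<close>

definition indep_mod :: "('b \<Rightarrow>\<^sub>0 int) set \<Rightarrow> ('b \<Rightarrow>\<^sub>0 int) set \<Rightarrow> bool"
  where "indep_mod L X \<longleftrightarrow> finite X \<and> (\<forall>c. int_comb c X \<in> L \<longrightarrow> (\<forall>x\<in>X. c x = 0))"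

lemma indep_modD: "indep_mod L X \<Longrightarrow> int_comb c X \<in> L \<Longrightarrow> x \<in> X \<Longrightarrow> c x = 0"
  by (simp add: indep_mod_def)

text \<open>Kronecker coefficients single out an element. The difference of two such functions
  represents x - y, which yields injectivity on independent sets in later proofs.\<close>

lemma sum_frag_cmul_delta:
  "finite X \<Longrightarrow> z \<in> X \<Longrightarrow> (\<Sum>x\<in>X. frag_cmul (if x = z then 1 else 0) (f x)) = f z"
  by (simp add: if_distrib[of "\<lambda>k. frag_cmul k _"] cong: if_cong)

text \<open>
  The set \<open>X\<close> below is a basis of \<open>M / L\<close> only after tensoring with the rationals, whence the factor \<open>k\<close>.
\<close>

definition rank_mod :: "('b \<Rightarrow>\<^sub>0 int) set \<Rightarrow> ('b \<Rightarrow>\<^sub>0 int) set \<Rightarrow> nat \<Rightarrow> bool"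
  where "rank_mod M L n \<longleftrightarrow> (\<exists>X\<subseteq>M. card X = n \<and> indep_mod L X \<and>
    (\<forall>y\<in>M. \<exists>k\<noteq>0. \<exists>c. frag_cmul k y - int_comb c X \<in> L))"

text \<open>Integral Gaussian elimination of the unknown \<open>s\<close> by cross multiplication avoids passing to a field.\<close>

lemma ex_nontrivial_int_solution:
  fixes a :: "'u \<Rightarrow> 't \<Rightarrow> int"
  assumes "finite U" "finite T" "card U < card T"
  shows "\<exists>c. (\<exists>t\<in>T. c t \<noteq> 0) \<and> (\<forall>u\<in>U. (\<Sum>t\<in>T. c t * a u t) = 0)"
  using assms
proof (induction U arbitrary: T a rule: finite_induct)
  case empty
  then have "T \<noteq> {}" by auto
  then show ?case by (intro exI[of _ "\<lambda>_. 1"]) auto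
next
  case (insert u U)
  show ?case
  proof (cases "\<forall>t\<in>T. a u t = 0")
    case True
    from insert have "card U < card T" by simp
    from insert.IH[OF insert.prems(1) this, of a]
    obtain c where "\<exists>t\<in>T. c t \<noteq> 0" "\<forall>u\<in>U. (\<Sum>t\<in>T. c t * a u t) = 0"
      by blast
    with True show ?thesis by (intro exI[of _ c]) simp
  next
    case False
    then obtain s where s: "s \<in> T" "a u s \<noteq> 0" by auto
    define a' where "a' v t = a u s * a v t - a u t * a v s" for v t
    from insert s have "card U < card (T - {s})" by simp
    from insert.IH[OF finite_Diff[OF insert.prems(1)] this, of a']
    obtain c where c: "\<exists>t\<in>T - {s}. c t \<noteq> 0"
        "\<forall>v\<in>U. (\<Sum>t\<in>T - {s}. c t * a' v t) = 0"
      by blast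
    \<comment> \<open>The coefficient at \<open>s\<close> solves equation \<open>u\<close>. All
      others are scaled by the nonzero integer \<open>a u s\<close>, so that no division occurs and
      the solution stays nontrivial.\<close>
    define d where "d t = (if t = s then - (\<Sum>t\<in>T - {s}. c t * a u t) else c t * a u s)" for t
    have split: "(\<Sum>t\<in>T. d t * a v t) = (\<Sum>t\<in>T - {s}. c t * a' v t)" for v
    proof -
      have "(\<Sum>t\<in>T. d t * a v t) = d s * a v s + (\<Sum>t\<in>T - {s}. d t * a v t)"
        using s insert.prems(1) by (simp add: sum.remove)
      also have "(\<Sum>t\<in>T - {s}. d t * a v t) = (\<Sum>t\<in>T - {s}. c t * a u s * a v t)"
        by (rule sum.cong) (auto simp: d_def)
      also have "d s * a v s + \<dots> = (\<Sum>t\<in>T - {s}. c t * a' v t)"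
        by (simp add: d_def a'_def sum_distrib_left sum_distrib_right sum_subtractf right_diff_distrib ac_simps)
      finally show ?thesis .
    qed
    have "(\<Sum>t\<in>T. d t * a u t) = 0"
      unfolding split by (simp add: a'_def)
    moreover have "\<exists>t\<in>T. d t \<noteq> 0"
      using c(1) s by (auto simp: d_def)
    ultimately show ?thesis
      using c(2) by (intro exI[of _ d]) (auto simp: split)
  qed
qed

text \<open>Some nonzero multiple of each \<open>y\<close> in \<open>Y\<close> is a combination of
  \<open>X\<close> modulo \<open>L\<close>. If \<open>Y\<close> had more elements than
  \<open>X\<close>, the coefficient vectors would satisfy a nontrivial integer relation, and this
  would make \<open>Y\<close> dependent modulo \<open>L\<close>.\<close>

lemma indep_mod_card_le:
  assumes L: "int_submodule L" and "rank_mod M L n" and Y: "Y \<subseteq> M" "indep_mod L Y"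
  shows "card Y \<le> n"
proof (rule ccontr)
  obtain X where X: "card X = n" "indep_mod L X"
    and span: "\<forall>y\<in>M. \<exists>k\<noteq>0. \<exists>c. frag_cmul k y - int_comb c X \<in> L"
    using assms(2) unfolding rank_mod_def by blast
  from X(2) Y(2) have fin: "finite X" "finite Y" by (auto simp: indep_mod_def)
  have "\<forall>y\<in>Y. \<exists>kc. fst kc \<noteq> 0 \<and> frag_cmul (fst kc) y - int_comb (snd kc) X \<in> L"
    using span Y(1) by (auto simp: subset_iff)
  then obtain kc where "\<forall>y\<in>Y. fst (kc y) \<noteq> 0 \<and>
      frag_cmul (fst (kc y)) y - int_comb (snd (kc y)) X \<in> L"
    by (rule bchoice[THEN exE])
  then obtain k d where kd: "\<And>y. y \<in> Y \<Longrightarrow> k y \<noteq> 0"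
      "\<And>y. y \<in> Y \<Longrightarrow> frag_cmul (k y) y - int_comb (d y) X \<in> L"
    using that[of "fst \<circ> kc" "snd \<circ> kc"] by simp
  assume "\<not> card Y \<le> n"
  with X(1) have "card X < card Y" by simp
  from ex_nontrivial_int_solution[OF fin this, of "\<lambda>x y. d y x"]
  obtain c where c: "\<exists>y\<in>Y. c y \<noteq> 0" "\<forall>x\<in>X. (\<Sum>y\<in>Y. c y * d y x) = 0" by blast
  have "(\<Sum>y\<in>Y. frag_cmul (c y) (int_comb (d y) X)) =
      (\<Sum>y\<in>Y. \<Sum>x\<in>X. frag_cmul (c y * d y x) x)"
    by (simp add: frag_cmul_sum)
  also have "\<dots> = (\<Sum>x\<in>X. frag_cmul (\<Sum>y\<in>Y. c y * d y x) x)"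
  proof (subst sum.swap, rule sum.cong[OF refl])
    fix x
    show "(\<Sum>y\<in>Y. frag_cmul (c y * d y x) x) = frag_cmul (\<Sum>y\<in>Y. c y * d y x) x"
      by (induction Y rule: infinite_finite_induct) (simp_all add: frag_cmul_distrib)
  qed
  also have "\<dots> = 0" using c(2) by simp
  finally have zero: "(\<Sum>y\<in>Y. frag_cmul (c y) (int_comb (d y) X)) = 0" .
  \<comment> \<open>\<open>zero\<close> removes the \<open>X\<close>-part and leaves a combination
    of \<open>Y\<close> with coefficients \<open>c y * k y\<close>; as every \<open>k y\<close> is
    nonzero, it is still nontrivial.\<close>
  have "(\<Sum>y\<in>Y. frag_cmul (c y) (frag_cmul (k y) y - int_comb (d y) X)) \<in> L"
    using kd(2) L by (intro int_submodule_sum int_submodule_cmul)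
  also have "(\<Sum>y\<in>Y. frag_cmul (c y) (frag_cmul (k y) y - int_comb (d y) X)) =
      int_comb (\<lambda>y. c y * k y) Y - (\<Sum>y\<in>Y. frag_cmul (c y) (int_comb (d y) X))"
    by (simp add: sum_subtractf frag_cmul_diff_right)
  finally have "int_comb (\<lambda>y. c y * k y) Y \<in> L" unfolding zero by simp
  then have "\<forall>y\<in>Y. c y * k y = 0"
    using Y(2) unfolding indep_mod_def by (elim conjE allE[of _ "\<lambda>y. c y * k y"]) simp
  with c(1) kd(1) show False by auto
qed

section \<open>Uniqueness and existence of the rank\<close>

lemma rank_mod_unique:
  "int_submodule L \<Longrightarrow> rank_mod M L n \<Longrightarrow> rank_mod M L n' \<Longrightarrow> n = n'"
  by (rule antisym) (metis indep_mod_card_le rank_mod_def)+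

lemma indep_mod_mono: "indep_mod L X \<Longrightarrow> L' \<subseteq> L \<Longrightarrow> indep_mod L' X"
  by (auto simp: indep_mod_def)

text \<open>A largest independent subset \<open>X\<close> of \<open>M\<close> works: adjoining
  \<open>y\<close> creates a relation modulo \<open>L\<close>, and the coefficient of
  \<open>y\<close> in it is nonzero because \<open>X\<close> alone is independent.\<close>

lemma ex_rank_mod:
  assumes L: "int_submodule L" and bound: "\<And>Y. Y \<subseteq> M \<Longrightarrow> indep_mod L Y \<Longrightarrow> card Y \<le> N"
  shows "\<exists>n. rank_mod M L n"
proof -
  have start: "{} \<subseteq> M \<and> indep_mod L {}" by (simp add: indep_mod_def)
  have "\<forall>Y. Y \<subseteq> M \<and> indep_mod L Y \<longrightarrow> card Y < Suc N"
    using bound by (simp add: less_Suc_eq_le)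
  from ex_has_greatest_nat[of "\<lambda>Y. Y \<subseteq> M \<and> indep_mod L Y", OF start this]
  obtain X where X: "X \<subseteq> M" "indep_mod L X"
    and max: "\<And>Y. Y \<subseteq> M \<and> indep_mod L Y \<Longrightarrow> card Y \<le> card X"
    by blast
  from X(2) have fin: "finite X" by (simp add: indep_mod_def)
  have "\<exists>k\<noteq>0. \<exists>c. frag_cmul k y - int_comb c X \<in> L" if y: "y \<in> M" for y
  proof (cases "y \<in> X")
    \<comment> \<open>Here adjoining \<open>y\<close> changes nothing, so maximality gives no
      relation; \<open>y\<close> is its own combination.\<close>
    case True
    have "int_comb (\<lambda>x. if x = y then 1 else 0) X = y"
      using fin True by (rule sum_frag_cmul_delta)
    then have "frag_cmul 1 y - int_comb (\<lambda>x. if x = y then 1 else 0) X = 0" by simp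
    then show ?thesis using int_submodule_0[OF L]
      by (intro exI[of _ 1] conjI exI[of _ "\<lambda>x. if x = y then 1 else 0"]) simp_all
  next
    case False
    then have "card (insert y X) > card X" using fin by simp
    with max[of "insert y X"] y X have "\<not> indep_mod L (insert y X)" by auto
    then obtain c where c: "int_comb c (insert y X) \<in> L" "\<exists>x\<in>insert y X. c x \<noteq> 0"
      using fin by (auto simp: indep_mod_def)
    have eq: "int_comb c (insert y X) = frag_cmul (c y) y + int_comb c X"
      using False fin by simp
    have "c y \<noteq> 0"
    proof
      assume "c y = 0"
      with c eq have "int_comb c X \<in> L" "\<exists>x\<in>X. c x \<noteq> 0" by auto
      with X(2) show False by (auto simp: indep_mod_def)
    qed
    moreover have "int_comb c (insert y X) = frag_cmul (c y) y - int_comb (\<lambda>x. - c x) X"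
      unfolding eq by (simp flip: minus_frag_cmul add: sum_negf)
    ultimately show ?thesis
      using c(1) by (intro exI[of _ "c y"] conjI exI[of _ "\<lambda>x. - c x"]) simp_all
  qed
  with X show ?thesis unfolding rank_mod_def by blast
qed

section \<open>Ranks of free groups, extensions and images\<close>

lemma rank_mod_free:
  fixes S :: "'b set"
  assumes "finite S"
  shows "rank_mod {c. Poly_Mapping.keys c \<subseteq> S} {0} (card S)"
  unfolding rank_mod_def
proof (intro exI conjI ballI)
  let ?X = "frag_of ` S"
  have inj: "inj_on frag_of S" by (simp add: inj_on_def frag_of_eq)
  show "?X \<subseteq> {c. Poly_Mapping.keys c \<subseteq> S}" by auto
  show "card ?X = card S" by (rule card_image[OF inj])
  have lookup: "Poly_Mapping.lookup (int_comb c ?X) s = c (frag_of s)" if "s \<in> S" for c s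
  proof -
    have "Poly_Mapping.lookup (int_comb c ?X) s = (\<Sum>t\<in>S. c (frag_of t) * Poly_Mapping.lookup (frag_of t) s)"
      by (simp add: sum.reindex[OF inj] lookup_sum)
    also have "\<dots> = (\<Sum>t\<in>S. if t = s then c (frag_of t) else 0)"
      by (rule sum.cong) (auto simp: lookup_single when_def)
    finally show ?thesis using assms that by (simp add: sum.delta)
  qed
  show "indep_mod {0} ?X"
    unfolding indep_mod_def
  proof (intro conjI allI impI ballI)
    fix c x assume "int_comb c ?X \<in> {0}" "x \<in> ?X"
    moreover from this obtain s where "s \<in> S" "x = frag_of s" by blast
    ultimately show "c x = 0" using lookup[of s c] by simp
  qed (use assms in auto)
  fix y :: "'b \<Rightarrow>\<^sub>0 int"
  assume y: "y \<in> {c. Poly_Mapping.keys c \<subseteq> S}"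
  \<comment> \<open>Coefficients are indexed by group elements, so the generator \<open>s\<close> is
    read off from \<open>frag_of s\<close> as the only point of its support.\<close>
  let ?c = "\<lambda>x. Poly_Mapping.lookup y (the_elem (Poly_Mapping.keys x))"
  have "int_comb ?c ?X = (\<Sum>s\<in>S. frag_cmul (Poly_Mapping.lookup y s) (frag_of s))"
    by (simp add: sum.reindex[OF inj])
  also have "\<dots> = (\<Sum>s\<in>Poly_Mapping.keys y. frag_cmul (Poly_Mapping.lookup y s) (frag_of s))"
    using y assms by (intro sum.mono_neutral_right) (auto simp: in_keys_iff)
  also have "\<dots> = y" using frag_expansion[of y] by (simp add: frag_extend_def)
  finally show "frag_cmul 1 y - int_comb ?c ?X \<in> {0}" by simp
qed simp

text \<open>A rational basis of \<open>L\<close> together with lifts of a rational basis of the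
  quotient is a rational basis of \<open>M\<close>.\<close>

lemma rank_mod_add:
  assumes L: "int_submodule L" "L \<subseteq> M"
    and "rank_mod L {0} p" "rank_mod M L q"
  shows "rank_mod M {0} (p + q)"
proof -
  obtain X where X: "X \<subseteq> L" "card X = p" "indep_mod {0} X"
    and Xspan: "\<And>y. y \<in> L \<Longrightarrow> \<exists>k\<noteq>0. \<exists>c. frag_cmul k y - int_comb c X \<in> {0}"
    using assms(3) unfolding rank_mod_def by blast
  obtain Y where Y: "Y \<subseteq> M" "card Y = q" "indep_mod L Y"
    and Yspan: "\<And>y. y \<in> M \<Longrightarrow> \<exists>k\<noteq>0. \<exists>c. frag_cmul k y - int_comb c Y \<in> L"
    using assms(4) unfolding rank_mod_def by blast
  have fin: "finite X" "finite Y" using X(3) Y(3) by (auto simp: indep_mod_def)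
  have disj: "X \<inter> Y = {}"
  proof (rule equals0I)
    fix z assume z: "z \<in> X \<inter> Y"
    have "int_comb (\<lambda>x. if x = z then 1 else 0) Y = z"
      using fin z by (intro sum_frag_cmul_delta) auto
    with z X(1) have "int_comb (\<lambda>x. if x = z then 1 else 0) Y \<in> L" by auto
    from indep_modD[OF Y(3) this, of z] z show False by simp
  qed
  have split: "int_comb c (X \<union> Y) = int_comb c X + int_comb c Y" for c
    by (rule sum.union_disjoint[OF fin disj])
  have comb_L: "int_comb c X \<in> L" for c
    using X(1) by (intro int_submodule_sum int_submodule_cmul L(1)) auto
  have "indep_mod {0} (X \<union> Y)"
    unfolding indep_mod_def
  proof (intro conjI allI impI)
    fix c assume "int_comb c (X \<union> Y) \<in> {0}"
    then have sum0: "int_comb c X + int_comb c Y = 0" by (simp add: split)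
    then have "int_comb c Y = - int_comb c X" by (simp add: eq_neg_iff_add_eq_0 add.commute)
    with comb_L L(1) have "int_comb c Y \<in> L" by (simp add: int_submodule_uminus del: minus_frag_cmul)
    with Y(3) have cY: "\<forall>x\<in>Y. c x = 0" by (simp add: indep_mod_def)
    then have "int_comb c Y = 0" by simp
    with sum0 have "int_comb c X \<in> {0}" by simp
    with X(3) have "\<forall>x\<in>X. c x = 0" unfolding indep_mod_def by blast
    with cY show "\<forall>x\<in>X \<union> Y. c x = 0" by blast
  qed (use fin in simp)
  moreover have "\<exists>k\<noteq>0. \<exists>c. frag_cmul k y - int_comb c (X \<union> Y) \<in> {0}" if y: "y \<in> M" for y
  proof -
    obtain k c where k: "k \<noteq> 0" and in_L: "frag_cmul k y - int_comb c Y \<in> L"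
      using Yspan[OF y] by blast
    obtain l d where l: "l \<noteq> 0" and eq: "frag_cmul l (frag_cmul k y - int_comb c Y) = int_comb d X"
      using Xspan[OF in_L] by auto
    \<comment> \<open>Both denominators are cleared in turn: \<open>k\<close> brings
      \<open>y\<close> into the span of \<open>Y\<close> modulo \<open>L\<close>, then
      \<open>l\<close> brings the remainder into the span of \<open>X\<close> and multiplies the
      coefficients on \<open>Y\<close>.\<close>
    let ?c = "\<lambda>x. if x \<in> X then d x else l * c x"
    have "int_comb ?c X = int_comb d X" by (rule sum.cong) auto
    moreover have "int_comb ?c Y = frag_cmul l (int_comb c Y)"
      unfolding frag_cmul_sum using disj by (intro sum.cong) auto
    ultimately have "int_comb ?c (X \<union> Y) = frag_cmul (l * k) y"
      using eq by (simp add: split frag_cmul_diff_right algebra_simps)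
    with k l show ?thesis by (intro exI[of _ "l * k"] conjI exI[of _ ?c]) auto
  qed
  moreover have "card (X \<union> Y) = p + q" using fin disj X(2) Y(2) by (simp add: card_Un_disjoint)
  moreover have "X \<union> Y \<subseteq> M" using X(1) Y(1) L(2) by blast
  ultimately show ?thesis unfolding rank_mod_def by blast
qed

text \<open>This is the homomorphism theorem for ranks: elements of \<open>M\<close> independent
  modulo the kernel are mapped injectively to independent elements of the image, and spanning is
  preserved.\<close>

lemma rank_mod_frag_extend_image:
  assumes M: "int_submodule M" and "rank_mod M {x \<in> M. frag_extend f x = 0} n"
  shows "rank_mod (frag_extend f ` M) {0} n"
proof -
  let ?h = "frag_extend f"
  obtain X where X: "X \<subseteq> M" "card X = n" "indep_mod {x \<in> M. ?h x = 0} X"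
    and span: "\<And>y. y \<in> M \<Longrightarrow> \<exists>k\<noteq>0. \<exists>c. frag_cmul k y - int_comb c X \<in> {x \<in> M. ?h x = 0}"
    using assms(2) unfolding rank_mod_def by blast
  have fin: "finite X" using X(3) by (simp add: indep_mod_def)
  have comb_M: "int_comb c X \<in> M" for c
    using X(1) M by (intro int_submodule_sum int_submodule_cmul) auto
  have h_comb: "?h (int_comb c X) = (\<Sum>x\<in>X. frag_cmul (c x) (?h x))" for c
    using fin by (simp add: frag_extend_sum frag_extend_cmul)
  have indep: "\<forall>x\<in>X. c x = 0" if "(\<Sum>x\<in>X. frag_cmul (c x) (?h x)) = 0" for c
    using X(3) that comb_M[of c] h_comb[of c] by (simp add: indep_mod_def)
  have inj: "inj_on ?h X"
  proof (rule inj_onI, rule ccontr)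
    fix x y assume xy: "x \<in> X" "y \<in> X" "?h x = ?h y" "x \<noteq> y"
    let ?c = "\<lambda>z. (if z = x then 1 else 0) - (if z = y then 1 else 0) :: int"
    have "(\<Sum>z\<in>X. frag_cmul (?c z) (?h z)) = ?h x - ?h y"
      using fin xy by (simp add: frag_cmul_diff_distrib sum_subtractf sum_frag_cmul_delta)
    also have "\<dots> = 0" using xy(3) by simp
    finally have "?c x = 0" using indep[of ?c] xy(1) by blast
    with xy(4) show False by simp
  qed
  have reindex: "int_comb c (?h ` X) = (\<Sum>x\<in>X. frag_cmul (c (?h x)) (?h x))" for c
    by (simp add: sum.reindex[OF inj])
  have "indep_mod {0} (?h ` X)"
    unfolding indep_mod_def
  proof (intro conjI allI impI)
    fix c assume "int_comb c (?h ` X) \<in> {0}"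
    with indep[of "\<lambda>x. c (?h x)"] show "\<forall>x\<in>?h ` X. c x = 0" by (simp add: reindex)
  qed (use fin in simp)
  moreover have "\<exists>k\<noteq>0. \<exists>c. frag_cmul k y - int_comb c (?h ` X) \<in> {0}" if "y \<in> ?h ` M" for y
  proof -
    from that obtain z where z: "z \<in> M" "y = ?h z" by auto
    obtain k c where k: "k \<noteq> 0" "?h (frag_cmul k z - int_comb c X) = 0"
      using span[OF z(1)] by blast
    have "int_comb (\<lambda>x. c (inv_into X ?h x)) (?h ` X) = ?h (int_comb c X)"
      unfolding reindex h_comb by (rule sum.cong) (simp_all add: inv_into_f_f[OF inj])
    with k z(2) show ?thesis
      by (intro exI[of _ k] conjI exI[of _ "\<lambda>x. c (inv_into X ?h x)"])
        (simp_all add: frag_extend_diff frag_extend_cmul)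
  qed
  moreover have "card (?h ` X) = n" "?h ` X \<subseteq> ?h ` M"
    using X card_image[OF inj] by auto
  ultimately show ?thesis unfolding rank_mod_def by blast
qed

text \<open>This ties the supremum in \<open>abelian_rank\<close> to \<open>rank_mod\<close>.
  Independent sets in the quotient group correspond, through a choice of representatives, to sets
  independent modulo \<open>L\<close>; these have at most \<open>n\<close> elements, and
  \<open>n\<close> is attained.\<close>

lemma abelian_rank_quotient:
  fixes S :: "'b set"
  assumes M: "int_submodule M" "M \<subseteq> carrier (free_Abelian_group S)"
    and L: "int_submodule L" "L \<subseteq> M" and rank: "rank_mod M L n"
  shows "abelian_rank (subgroup_generated (free_Abelian_group S) M Mod L) = n"
proof -
  define F where "F = free_Abelian_group S"
  define G where "G = subgroup_generated F M"
  define H where "H = G Mod L"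
  interpret F: comm_group F unfolding F_def by (rule abelian_free_Abelian_group)
  have F_simps: "\<And>x y. x \<otimes>\<^bsub>F\<^esub> y = x + y" "\<one>\<^bsub>F\<^esub> = 0" by (simp_all add: F_def)
  have subgroup: "subgroup N F" if "int_submodule N" "N \<subseteq> M" for N
  proof (rule F.subgroupI)
    show "N \<subseteq> carrier F" using that M(2) by (auto simp: F_def)
    show "N \<noteq> {}" using int_submodule_0[OF that(1)] by auto
    fix x y assume x: "x \<in> N" and y: "y \<in> N"
    show "x \<otimes>\<^bsub>F\<^esub> y \<in> N" using that(1) x y by (simp add: F_simps int_submodule_add)
    from x that M(2) have "x \<in> carrier (free_Abelian_group S)" by blast
    then have "Poly_Mapping.keys x \<subseteq> S" by simp
    then show "inv\<^bsub>F\<^esub> x \<in> N" using that(1) x by (simp add: F_def int_submodule_uminus)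
  qed
  interpret G: comm_group G
    unfolding G_def by (rule F.abelian_subgroup_generated) (rule F.comm_group_axioms)
  have carG: "carrier G = M"
    unfolding G_def by (rule subgroup.carrier_subgroup_generated_subgroup[OF subgroup[OF M(1) order_refl]])
  have G_simps: "\<And>x y. x \<otimes>\<^bsub>G\<^esub> y = x + y" "\<one>\<^bsub>G\<^esub> = 0" by (simp_all add: G_def F_simps)
  have pow: "x [^]\<^bsub>G\<^esub> k = frag_cmul k x" if "x \<in> M" for x and k :: int
  proof -
    have "x [^]\<^bsub>G\<^esub> k = x [^]\<^bsub>F\<^esub> k"
      unfolding G_def by (rule F.int_pow_subgroup_generated) (use that carG G_def in simp)
    also have "\<dots> = frag_cmul k x"
      unfolding F_def using subsetD[OF M(2) that] by (intro int_pow_free_Abelian_group) simp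
    finally show ?thesis .
  qed
  have subL: "subgroup L G"
    unfolding G_def F.subgroup_subgroup_generated_iff
    using subgroup[OF L] L(2) carG by (simp add: G_def)
  then have normal: "L \<lhd> G" by (rule G.subgroup_imp_normal)
  interpret H: comm_group H unfolding H_def by (rule G.abelian_FactGroup[OF subL])
  define \<pi> where "\<pi> x = L #>\<^bsub>G\<^esub> x" for x
  interpret \<pi>: group_hom G H \<pi>
    unfolding group_hom_def group_hom_axioms_def
    using normal.r_coset_hom_Mod[OF normal] G.group_axioms H.group_axioms
    by (simp add: H_def \<pi>_def[abs_def])
  have carH: "carrier H = \<pi> ` M"
    by (auto simp: H_def FactGroup_def RCOSETS_def carG \<pi>_def)
  have \<pi>_closed: "\<pi> x \<in> carrier H" if "x \<in> M" for x using that by (simp add: carH)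
  have \<pi>_one: "\<pi> x = \<one>\<^bsub>H\<^esub> \<longleftrightarrow> x \<in> L" if "x \<in> M" for x
    using that G.coset_join1[OF _ _ subL, of x] G.coset_join2[OF _ subL, of x] carG
    by (auto simp: H_def FactGroup_def \<pi>_def)
  have \<pi>_eq: "x - y \<in> L" if "x \<in> M" "y \<in> M" "\<pi> x = \<pi> y" for x y
  proof -
    have "\<pi> (frag_cmul (-1) y) = inv\<^bsub>H\<^esub> \<pi> y"
      using that pow[of y "-1"] \<pi>.hom_int_pow[of y "-1"] carG by (simp add: H.int_pow_neg)
    moreover have "\<pi> (x + - y) = \<pi> x \<otimes>\<^bsub>H\<^esub> \<pi> (- y)"
      using \<pi>.hom_mult[of x "- y"] that M(1) by (simp add: carG G_simps int_submodule_uminus)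
    ultimately have "\<pi> (x - y) = \<one>\<^bsub>H\<^esub>"
      using that carH by simp
    then show ?thesis using \<pi>_one int_submodule_diff[OF M(1)] that by simp
  qed
  \<comment> \<open>A product of powers in the quotient is the class of the integer combination, so
    \<open>int_independent\<close> in \<open>H\<close> can be compared with independence modulo
    \<open>L\<close>.\<close>
  have prod: "finprod H (\<lambda>x. \<pi> x [^]\<^bsub>H\<^esub> (c x::int)) X = \<pi> (int_comb c X)" if "finite X" "X \<subseteq> M" for c X
    using that
  proof (induction X rule: finite_induct)
    case empty
    then show ?case using \<pi>.hom_one by (simp add: G_simps)
  next
    case (insert x X)
    have closed: "\<pi> ` insert x X \<subseteq> carrier H" using insert.prems carH by auto
    have "frag_cmul (c x) x \<in> M" "int_comb c X \<in> M"
      using insert.prems M(1) by (auto intro!: int_submodule_sum int_submodule_cmul)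
    then have "\<pi> (frag_cmul (c x) x + int_comb c X) = \<pi> (frag_cmul (c x) x) \<otimes>\<^bsub>H\<^esub> \<pi> (int_comb c X)"
      using \<pi>.hom_mult by (simp add: carG G_simps)
    also have "\<pi> (frag_cmul (c x) x) = \<pi> x [^]\<^bsub>H\<^esub> c x"
      using \<pi>.hom_int_pow[of x "c x"] insert.prems pow by (simp add: carG)
    finally show ?case
      using insert closed by (subst H.finprod_insert) auto
  qed
  \<comment> \<open>Independence modulo \<open>L\<close> makes the projection injective on
    \<open>X\<close>. For \<open>card X = n\<close>, the bound \<open>le\<close> turns the
    inequality of cardinalities into an equality.\<close>
  have fwd: "card X \<le> card (\<pi> ` X) \<and> int_independent H (\<pi> ` X)" if "X \<subseteq> M" "indep_mod L X" for X
  proof -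
    have fin: "finite X" using that by (simp add: indep_mod_def)
    have inj: "inj_on \<pi> X"
    proof (rule inj_onI, rule ccontr)
      fix x y assume xy: "x \<in> X" "y \<in> X" "\<pi> x = \<pi> y" "x \<noteq> y"
      let ?c = "\<lambda>z. (if z = x then 1 else 0) - (if z = y then 1 else 0) :: int"
      have "int_comb ?c X = x - y"
        using fin xy by (simp add: frag_cmul_diff_distrib sum_subtractf sum_frag_cmul_delta)
      also have "\<dots> \<in> L" using \<pi>_eq xy that(1) by auto
      finally have "?c x = 0" by (rule indep_modD[OF that(2) _ xy(1)])
      with xy(4) show False by simp
    qed
    have "\<forall>t\<in>\<pi> ` X. c t = 0" if c: "finprod H (\<lambda>t. t [^]\<^bsub>H\<^esub> (c t::int)) (\<pi> ` X) = \<one>\<^bsub>H\<^esub>" for c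
    proof -
      have "finprod H (\<lambda>t. t [^]\<^bsub>H\<^esub> c t) (\<pi> ` X) = finprod H (\<lambda>x. \<pi> x [^]\<^bsub>H\<^esub> c (\<pi> x)) X"
        using \<open>X \<subseteq> M\<close> \<pi>_closed by (intro H.finprod_reindex inj) (auto intro!: H.int_pow_closed)
      with c prod[OF fin \<open>X \<subseteq> M\<close>, of "\<lambda>x. c (\<pi> x)"]
      have "\<pi> (int_comb (\<lambda>x. c (\<pi> x)) X) = \<one>\<^bsub>H\<^esub>" by simp
      moreover have "int_comb (\<lambda>x. c (\<pi> x)) X \<in> M"
        using \<open>X \<subseteq> M\<close> by (intro int_submodule_sum int_submodule_cmul M(1)) auto
      ultimately have "int_comb (\<lambda>x. c (\<pi> x)) X \<in> L" by (simp add: \<pi>_one)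
      then have "c (\<pi> x) = 0" if "x \<in> X" for x
        using that by (rule indep_modD[OF \<open>indep_mod L X\<close>])
      then show ?thesis by blast
    qed
    then show ?thesis
      using fin that(1) carH card_image[OF inj] unfolding int_independent_def by auto
  qed
  have bwd: "\<exists>X\<subseteq>M. indep_mod L X \<and> card X = card T" if T: "int_independent H T" for T
  proof -
    have sub: "T \<subseteq> \<pi> ` M" and fin: "finite T"
      using T by (auto simp: int_independent_def carH)
    \<comment> \<open>One representative is taken from each class, so the projection restricts to a
      bijection from \<open>X\<close> to \<open>T\<close>.\<close>
    define X where "X = inv_into M \<pi> ` T"
    have X: "X \<subseteq> M" "finite X" "\<pi> ` X = T"
      using sub fin by (auto simp: X_def inv_into_into f_inv_into_f image_image subset_iff image_iff)
    have card: "card X = card T"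
      unfolding X_def by (rule card_image) (rule inj_on_inv_into[OF sub])
    then have inj: "inj_on \<pi> X" using X(2,3) by (simp add: eq_card_imp_inj_on)
    have "indep_mod L X"
      unfolding indep_mod_def
    proof (intro conjI allI impI)
      fix c assume c: "int_comb c X \<in> L"
      let ?d = "\<lambda>t. c (inv_into X \<pi> t)"
      have "finprod H (\<lambda>t. t [^]\<^bsub>H\<^esub> ?d t) T = finprod H (\<lambda>x. \<pi> x [^]\<^bsub>H\<^esub> ?d (\<pi> x)) X"
        unfolding X(3)[symmetric] using X(1) \<pi>_closed
        by (intro H.finprod_reindex inj) (auto intro!: H.int_pow_closed)
      also have "\<dots> = \<pi> (int_comb (\<lambda>x. ?d (\<pi> x)) X)" by (rule prod[OF X(2,1)])
      also have "int_comb (\<lambda>x. ?d (\<pi> x)) X = int_comb c X"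
        by (rule sum.cong) (simp_all add: inv_into_f_f[OF inj])
      also have "\<pi> \<dots> = \<one>\<^bsub>H\<^esub>" using c L(2) \<pi>_one by auto
      finally have prod_one: "finprod H (\<lambda>t. t [^]\<^bsub>H\<^esub> ?d t) T = \<one>\<^bsub>H\<^esub>" .
      from T have "finprod H (\<lambda>t. t [^]\<^bsub>H\<^esub> ?d t) T = \<one>\<^bsub>H\<^esub> \<longrightarrow> (\<forall>t\<in>T. ?d t = 0)"
        unfolding int_independent_def by (elim conjE) (erule spec)
      with prod_one have d0: "\<forall>t\<in>T. ?d t = 0" by (rule mp[rotated])
      show "\<forall>x\<in>X. c x = 0"
      proof
        fix x assume x: "x \<in> X"
        with d0 X(3) have "?d (\<pi> x) = 0" by blast
        then show "c x = 0" by (simp add: inv_into_f_f[OF inj x])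
      qed
    qed (fact X(2))
    with X(1) card show ?thesis by blast
  qed
  have le: "card T \<le> n" if "int_independent H T" for T
    using bwd[OF that] indep_mod_card_le[OF L(1) rank] by metis
  obtain X where "X \<subseteq> M" "indep_mod L X" "card X = n" using rank unfolding rank_mod_def by blast
  then have "\<exists>T. int_independent H T \<and> card T = n"
    using fwd[of X] le by (metis antisym)
  then have "Sup {card T |T. int_independent H T} = n"
    using le by (intro cSup_eq_maximum) auto
  then show ?thesis by (simp add: abelian_rank_def H_def G_def F_def)
qed


section \<open>The Euler characteristic of the colored graph\<close>

lemma mem_relations:
  "I \<in> relations A B m l \<longleftrightarrow>
    I \<subseteq> A \<and> int (card I) = l + 1 \<and> (\<exists>b\<in>B. m = b + (\<Sum>a\<in>I. a))"
  by (simp add: relations_def diff_emb_minus_in_iff)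

lemma finite_relations: "finite A \<Longrightarrow> finite (relations A B m l)"
  by (rule finite_subset[of _ "Pow A"]) (auto simp: mem_relations)

text \<open>\<open>boundary\<close> is the linear extension of these values, which gives its
  linearity and lets \<open>rank_mod_frag_extend_image\<close> apply.\<close>

definition boundary_simplex ::
    "'a::fg_positive_cancel_semigroup set \<Rightarrow> 'a set \<Rightarrow> 'a \<Rightarrow> int \<Rightarrow> 'a set \<Rightarrow> ('a set \<Rightarrow>\<^sub>0 int)"
  where "boundary_simplex A B m l I = boundary A B m l (frag_of I)"

lemma frag_extend_frag_extend:
  "frag_extend f (frag_extend g c) = frag_extend (\<lambda>x. frag_extend f (g x)) c"
  by (simp add: frag_extend_def[of g] frag_extend_def[of "\<lambda>x. frag_extend f (g x)"]
      frag_extend_sum frag_extend_cmul)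

lemma boundary_eq_frag_extend: "boundary A B m l = frag_extend (boundary_simplex A B m l)"
  by (rule ext)
    (simp add: boundary_def boundary_simplex_def[abs_def] project_onto_def simplex_boundary_def
      frag_extend_frag_extend)

text \<open>The vertex order comes from \<open>A\<close> and so is the same for a simplex and all
  its faces.\<close>

definition face_sign :: "'a set \<Rightarrow> 'a set \<Rightarrow> 'a \<Rightarrow> int"
  where "face_sign A I i = (-1) ^ card {j \<in> I. to_nat_on A j < to_nat_on A i}"

definition frag_of_relation ::
    "'a::fg_positive_cancel_semigroup set \<Rightarrow> 'a set \<Rightarrow> 'a \<Rightarrow> int \<Rightarrow> 'a set \<Rightarrow> ('a set \<Rightarrow>\<^sub>0 int)"
  where "frag_of_relation A B m l I = (if I \<in> relations A B m l then frag_of I else 0)"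

lemma boundary_simplex_eq:
  assumes "finite I"
  shows "boundary_simplex A B m l I =
    (\<Sum>i\<in>I. frag_cmul (face_sign A I i) (frag_of_relation A B m (l - 1) (I - {i})))"
  using assms
  by (simp add: boundary_simplex_def boundary_def project_onto_def simplex_boundary_def
      frag_extend_sum frag_extend_cmul face_sign_def frag_of_relation_def)

text \<open>Deleting the earlier of two vertices lowers the position of the later one by one, while
  deleting the later one leaves the position of the earlier unchanged.\<close>

lemma face_sign_swap:
  assumes A: "finite A" and I: "I \<subseteq> A" "i \<in> I" "j \<in> I" "i \<noteq> j"
  shows "face_sign A I i * face_sign A (I - {i}) j = - (face_sign A I j * face_sign A (I - {j}) i)"
proof -
  have fin: "finite I" using A I(1) by (rule finite_subset[rotated])
  have *: "face_sign A I i * face_sign A (I - {i}) j = - (face_sign A I j * face_sign A (I - {j}) i)"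
    if "i \<in> I" "j \<in> I" and less: "to_nat_on A i < to_nat_on A j" for i j
  proof -
    let ?S = "{k \<in> I. to_nat_on A k < to_nat_on A j}"
    have "?S = insert i {k \<in> I - {i}. to_nat_on A k < to_nat_on A j}"
      using that by auto
    then have "card ?S = Suc (card {k \<in> I - {i}. to_nat_on A k < to_nat_on A j})"
      using fin by simp
    moreover have "{k \<in> I - {j}. to_nat_on A k < to_nat_on A i} =
        {k \<in> I. to_nat_on A k < to_nat_on A i}"
      using less by auto
    ultimately show ?thesis by (simp add: face_sign_def)
  qed
  \<comment> \<open>The claim is symmetric in \<open>i\<close> and \<open>j\<close>, so it suffices
    that one of the two comes first.\<close>
  have "to_nat_on A i \<noteq> to_nat_on A j"
    using inj_on_to_nat_on[OF countable_finite[OF A]] I by (auto dest: inj_onD)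
  then show ?thesis using *[of i j] *[of j i] I by linarith
qed

lemma keys_boundary: "Poly_Mapping.keys (boundary A B m l c) \<subseteq> relations A B m (l - 1)"
proof -
  have "Poly_Mapping.keys (boundary A B m l c) \<subseteq>
      (\<Union>I\<in>Poly_Mapping.keys (simplex_boundary A c).
        Poly_Mapping.keys (if I \<in> relations A B m (l - 1) then frag_of I else 0))"
    unfolding boundary_def project_onto_def by (rule keys_frag_extend)
  also have "\<dots> \<subseteq> relations A B m (l - 1)" by (auto split: if_splits)
  finally show ?thesis .
qed

section \<open>The chain complex at a fixed element\<close>

locale colored_graph =
  fixes A B :: "'a::fg_positive_cancel_semigroup set" and m :: 'a
  assumes finite_A: "finite A"
    and interval_closed: "\<And>b n n'. b \<in> B \<Longrightarrow> b + n + n' \<in> B \<Longrightarrow> b + n \<in> B \<and> b + n' \<in> B"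
begin

text \<open>
  If \<open>m - a\<^sub>I = b\<close>, then removing \<open>i\<close> and \<open>j\<close> from \<open>I\<close> gives \<open>b + i + j\<close>. This is the only place
  where the hypothesis on \<open>B\<close> enters.
\<close>

lemma relation_intermediate:
  assumes I: "I \<in> relations A B m l" "i \<in> I" "j \<in> I" "i \<noteq> j"
    and "I - {i} - {j} \<in> relations A B m (l - 2)"
  shows "I - {i} \<in> relations A B m (l - 1)"
proof -
  from I(1) have sub: "I \<subseteq> A" "int (card I) = l + 1" by (auto simp: mem_relations)
  have fin: "finite I" using finite_A sub(1) by (rule finite_subset[rotated])
  obtain b where b: "b \<in> B" "m = b + (\<Sum>a\<in>I. a)" using I(1) by (auto simp: mem_relations)
  obtain b' where b': "b' \<in> B" "m = b' + (\<Sum>a\<in>I - {i} - {j}. a)"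
    using assms(5) by (auto simp: mem_relations)
  have s1: "(\<Sum>a\<in>I. a) = i + (\<Sum>a\<in>I - {i}. a)"
    using I fin by (intro sum.remove) auto
  have s2: "(\<Sum>a\<in>I - {i}. a) = j + (\<Sum>a\<in>I - {i} - {j}. a)"
    using I fin by (intro sum.remove) auto
  have "b + i + j + (\<Sum>a\<in>I - {i} - {j}. a) = b' + (\<Sum>a\<in>I - {i} - {j}. a)"
    using b(2) b'(2) s1 s2 by (simp add: add.assoc)
  then have "b + i + j \<in> B" using b'(1) by (metis cancelative)
  with b(1) have "b + i \<in> B" using interval_closed by blast
  moreover have "m = b + i + (\<Sum>a\<in>I - {i}. a)" using b(2) s1 by (simp add: add.assoc)
  moreover have "int (card (I - {i})) = l"
    using sub(2) I(2) fin card_Suc_Diff1[of I i] by linarith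
  ultimately show ?thesis using sub(1) by (auto simp: mem_relations)
qed

text \<open>Deleting two vertices in either order gives terms that cancel in pairs, as for the full
  simplex. The projection does not disturb this: if \<open>I - {i}\<close> is not a relation, then
  neither is any \<open>I - {i} - {j}\<close>.\<close>

lemma boundary_boundary_simplex:
  assumes I: "I \<in> relations A B m l"
  shows "boundary A B m (l - 1) (boundary_simplex A B m l I) = 0"
proof -
  let ?g = "frag_of_relation A B m (l - 2)"
  have sub: "I \<subseteq> A" using I by (simp add: mem_relations)
  have fin: "finite I" using finite_A sub by (rule finite_subset[rotated])
  define w where "w i j =
    frag_cmul (face_sign A I i * face_sign A (I - {i}) j) (?g (I - {i} - {j}))" for i j
  have step: "boundary A B m (l - 1) (frag_of_relation A B m (l - 1) (I - {i})) =
      (\<Sum>j\<in>I - {i}. frag_cmul (face_sign A (I - {i}) j) (?g (I - {i} - {j})))" if i: "i \<in> I" for i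
  proof (cases "I - {i} \<in> relations A B m (l - 1)")
    case True
    then have "boundary A B m (l - 1) (frag_of_relation A B m (l - 1) (I - {i})) =
        boundary_simplex A B m (l - 1) (I - {i})"
      by (simp add: frag_of_relation_def boundary_simplex_def)
    also have "\<dots> = (\<Sum>j\<in>I - {i}. frag_cmul (face_sign A (I - {i}) j) (?g (I - {i} - {j})))"
      using fin by (simp add: boundary_simplex_eq)
    finally show ?thesis .
  next
    case False
    then have "?g (I - {i} - {j}) = 0" if "j \<in> I - {i}" for j
      using relation_intermediate[OF I i, of j] that by (auto simp: frag_of_relation_def)
    with False show ?thesis
      by (simp add: frag_of_relation_def boundary_eq_frag_extend)
  qed
  have "boundary A B m (l - 1) (boundary_simplex A B m l I) =
      (\<Sum>i\<in>I. frag_cmul (face_sign A I i)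
        (boundary A B m (l - 1) (frag_of_relation A B m (l - 1) (I - {i}))))"
    using fin
    by (simp add: boundary_simplex_eq boundary_eq_frag_extend frag_extend_sum frag_extend_cmul)
  also have "\<dots> = (\<Sum>i\<in>I. \<Sum>j\<in>I - {i}. w i j)"
    by (rule sum.cong) (simp_all add: step w_def frag_cmul_sum)
  finally have eq: "boundary A B m (l - 1) (boundary_simplex A B m l I) =
      (\<Sum>i\<in>I. \<Sum>j\<in>I - {i}. w i j)" .
  have "(\<Sum>i\<in>I. \<Sum>j\<in>I - {i}. w i j) = (\<Sum>i\<in>I. \<Sum>j\<in>I - {i}. - w j i)"
  proof (intro sum.cong refl)
    fix i j assume "i \<in> I" "j \<in> I - {i}"
    moreover have "I - {i} - {j} = I - {j} - {i}" by blast
    moreover from calculation have "face_sign A I i * face_sign A (I - {i}) j =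
        - (face_sign A I j * face_sign A (I - {j}) i)"
      by (intro face_sign_swap[OF finite_A sub]) auto
    ultimately show "w i j = - w j i" by (simp add: w_def)
  qed
  also have "\<dots> = - (\<Sum>i\<in>I. \<Sum>j\<in>{j \<in> I. j \<noteq> i}. w j i)"
    by (simp add: sum_negf set_diff_eq)
  also have "(\<Sum>i\<in>I. \<Sum>j\<in>{j \<in> I. j \<noteq> i}. w j i) = (\<Sum>j\<in>I. \<Sum>i\<in>{i \<in> I. j \<noteq> i}. w j i)"
    by (rule sum.swap_restrict[OF fin fin])
  also have "\<dots> = (\<Sum>i\<in>I. \<Sum>j\<in>I - {i}. w i j)"
    by (intro sum.cong) auto
  \<comment> \<open>The sum equals its own negative, so each of its integer coefficients is
    0.\<close>
  finally have "(\<Sum>i\<in>I. \<Sum>j\<in>I - {i}. w i j) = 0"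
    by (auto intro!: poly_mapping_eqI dest: arg_cong[where f = Poly_Mapping.lookup] simp: fun_eq_iff)
  with eq show ?thesis by simp
qed

lemma boundary_boundary:
  assumes "Poly_Mapping.keys c \<subseteq> relations A B m l"
  shows "boundary A B m (l - 1) (boundary A B m l c) = 0"
proof -
  have "boundary A B m (l - 1) (boundary A B m l c) =
      frag_extend (\<lambda>I. boundary A B m (l - 1) (boundary_simplex A B m l I)) c"
    by (simp add: boundary_eq_frag_extend frag_extend_frag_extend)
  also have "\<dots> = 0"
    using assms boundary_boundary_simplex by (intro frag_extend_eq_0) auto
  finally show ?thesis .
qed

section \<open>Homology ranks and the Euler characteristic\<close>

definition chains :: "int \<Rightarrow> ('a set \<Rightarrow>\<^sub>0 int) set"
  where "chains l = {c. Poly_Mapping.keys c \<subseteq> relations A B m l}"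

lemma carrier_chain_gp: "carrier (chain_gp A B m l) = chains l"
  by (auto simp: chain_gp_def chains_def)

lemma int_submodule_chains: "int_submodule (chains l)"
  using keys_diff unfolding int_submodule_def chains_def by fastforce

definition cycles :: "int \<Rightarrow> ('a set \<Rightarrow>\<^sub>0 int) set"
  where "cycles l = {c \<in> chains l. boundary A B m l c = 0}"

definition boundaries :: "int \<Rightarrow> ('a set \<Rightarrow>\<^sub>0 int) set"
  where "boundaries l = boundary A B m (l + 1) ` chains (l + 1)"

lemma int_submodule_cycles: "int_submodule (cycles l)"
  using int_submodule_chains[of l]
  by (auto simp: int_submodule_def cycles_def boundary_eq_frag_extend frag_extend_diff)

lemma int_submodule_boundaries: "int_submodule (boundaries l)"
  unfolding int_submodule_def
proof (intro conjI ballI)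
  have "boundary A B m (l + 1) 0 = 0" by (simp add: boundary_eq_frag_extend)
  then show "0 \<in> boundaries l"
    using int_submodule_0[OF int_submodule_chains] unfolding boundaries_def by (metis imageI)
  fix x y assume "x \<in> boundaries l" "y \<in> boundaries l"
  then obtain c d where "c \<in> chains (l + 1)" "d \<in> chains (l + 1)"
      "x = boundary A B m (l + 1) c" "y = boundary A B m (l + 1) d"
    by (auto simp: boundaries_def)
  then show "x - y \<in> boundaries l"
    using int_submodule_diff[OF int_submodule_chains]
    by (auto simp: boundaries_def boundary_eq_frag_extend frag_extend_diff[symmetric])
qed

lemma boundaries_subset_cycles: "boundaries l \<subseteq> cycles l"
  using keys_boundary[of A B m "l + 1"] boundary_boundary[of _ "l + 1"]
  by (auto simp: boundaries_def cycles_def chains_def)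

lemma homology_gp_eq:
  "homology_gp A B m l = subgroup_generated (free_Abelian_group (relations A B m l)) (cycles l)
    Mod boundaries l"
proof -
  have "kernel (chain_gp A B m l) (chain_gp A B m (l - 1)) (boundary A B m l) = cycles l"
    by (simp add: kernel_def carrier_chain_gp cycles_def) (simp add: chain_gp_def)
  then show ?thesis
    by (simp add: homology_gp_def boundaries_def carrier_chain_gp) (simp add: chain_gp_def)
qed

lemma rank_chains: "rank_mod (chains l) {0} (card (relations A B m l))"
  unfolding chains_def by (rule rank_mod_free) (rule finite_relations[OF finite_A])

text \<open>Independence modulo \<open>L\<close> implies independence modulo 0, so the number of
  relations bounds the size of every independent subset of \<open>M\<close>.\<close>

lemma ex_rank_chains:
  assumes "int_submodule L" "M \<subseteq> chains l"
  shows "\<exists>n. rank_mod M L n"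
proof (rule ex_rank_mod[OF assms(1)])
  fix Y assume "Y \<subseteq> M" "indep_mod L Y"
  then show "card Y \<le> card (relations A B m l)"
    using assms int_submodule_0[of L]
    by (intro indep_mod_card_le[OF _ rank_chains[of l]])
      (auto simp: int_submodule_def intro: indep_mod_mono)
qed

lemma ex_homology_rank:
  "\<exists>\<beta>. \<forall>l. int (abelian_rank (homology_gp A B m l)) + \<beta> l + \<beta> (l - 1) =
      int (card (relations A B m l)) \<and> \<beta> l \<ge> 0"
proof -
  have sub0: "int_submodule {0}" by (simp add: int_submodule_def)
  have "\<exists>n. rank_mod (boundaries l) {0} n" for l
    using boundaries_subset_cycles[of l] by (intro ex_rank_chains[OF sub0, of _ l]) (auto simp: cycles_def)
  then obtain \<beta> where \<beta>: "\<And>l. rank_mod (boundaries l) {0} (\<beta> l)" by metis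
  have "abelian_rank (homology_gp A B m l) + \<beta> l + \<beta> (l - 1) = card (relations A B m l)" for l
  proof -
    have cyc: "cycles l \<subseteq> chains l" by (auto simp: cycles_def)
    obtain h where h: "rank_mod (cycles l) (boundaries l) h"
      using ex_rank_chains[OF int_submodule_boundaries cyc] by blast
    have "abelian_rank (homology_gp A B m l) = h"
      unfolding homology_gp_eq using cyc
      by (intro abelian_rank_quotient int_submodule_cycles int_submodule_boundaries
          boundaries_subset_cycles h) (auto simp: chains_def)
    moreover obtain r where r: "rank_mod (chains l) (cycles l) r"
      using ex_rank_chains[OF int_submodule_cycles order_refl] by blast
    \<comment> \<open>The boundary maps \<open>chains l\<close> onto
      \<open>boundaries (l - 1)\<close> with kernel \<open>cycles l\<close>.\<close>
    then have "rank_mod (boundaries (l - 1)) {0} r"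
      using rank_mod_frag_extend_image[OF int_submodule_chains, of l "boundary_simplex A B m l" r]
      by (simp add: cycles_def boundaries_def boundary_eq_frag_extend)
    then have "r = \<beta> (l - 1)" using \<beta> rank_mod_unique[OF sub0] by blast
    \<comment> \<open>Ranks are added twice, along boundaries \<subseteq> cycles \<subseteq>
      chains.\<close>
    moreover have "rank_mod (cycles l) {0} (\<beta> l + h)"
      by (rule rank_mod_add[OF int_submodule_boundaries boundaries_subset_cycles \<beta> h])
    then have "rank_mod (chains l) {0} (\<beta> l + h + r)"
      by (rule rank_mod_add[OF int_submodule_cycles cyc _ r])
    then have "\<beta> l + h + r = card (relations A B m l)"
      using rank_chains rank_mod_unique[OF sub0] by blast
    ultimately show ?thesis by simp
  qed
  then show ?thesis by (intro exI[of _ "\<lambda>l. int (\<beta> l)"]) (metis of_nat_add of_nat_0_le_iff)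
qed

text \<open>This is the Euler-Poincare formula. Each \<open>\<beta> l\<close> enters from two
  consecutive degrees with opposite signs; only the two end terms are left, and they are
  zero.\<close>

lemma euler_char_eq_relations:
  "euler_char A B m = (\<Sum>l = -1..int (card A) - 1. (-1) ^ nat \<bar>l\<bar> * int (card (relations A B m l)))"
proof -
  obtain \<beta> where \<beta>: "\<And>l. int (abelian_rank (homology_gp A B m l)) + \<beta> l + \<beta> (l - 1) =
      int (card (relations A B m l))" "\<And>l. \<beta> l \<ge> 0"
    using ex_homology_rank by blast
  \<comment> \<open>In a degree without relations the three nonnegative ranks add up to 0, so each
    of them is 0.\<close>
  have vanish: "\<beta> l = 0" if "relations A B m l = {} \<or> relations A B m (l + 1) = {}" for l
    using that \<beta>(1)[of l] \<beta>(1)[of "l + 1"] \<beta>(2)[of l] \<beta>(2)[of "l - 1"] \<beta>(2)[of "l + 1"] by auto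
  have "relations A B m (-2) = {}" by (auto simp: mem_relations)
  then have low: "\<beta> (-2) = 0" by (rule vanish[OF disjI1])
  have "I \<notin> relations A B m (int (card A))" for I
    using card_mono[OF finite_A, of I] by (auto simp: mem_relations)
  then have "relations A B m (int (card A)) = {}" by blast
  then have high: "\<beta> (int (card A) - 1) = 0" using vanish[of "int (card A) - 1"] by simp
  \<comment> \<open>With upper limit \<open>int k - 1\<close> the induction starts from the single
    degree -1, where \<open>low\<close> removes \<open>\<beta> (-2)\<close>.\<close>
  have telescope: "(\<Sum>l = -1..int k - 1. (-1) ^ nat \<bar>l\<bar> * (\<beta> l + \<beta> (l - 1))) =
      (-1) ^ Suc k * \<beta> (int k - 1)" for k
  proof (induction k)
    case 0
    then show ?case using low by simp
  next
    case (Suc k)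
    have "{-1..int (Suc k) - 1} = insert (int k) {-1..int k - 1}" by auto
    then show ?case using Suc by (simp add: algebra_simps)
  qed
  have "(\<Sum>l = -1..int (card A) - 1. (-1) ^ nat \<bar>l\<bar> * int (card (relations A B m l))) =
      euler_char A B m +
      (\<Sum>l = -1..int (card A) - 1. (-1) ^ nat \<bar>l\<bar> * (\<beta> l + \<beta> (l - 1)))"
    unfolding euler_char_def \<beta>(1)[symmetric] by (simp add: sum.distrib algebra_simps)
  also have "\<dots> = euler_char A B m" by (simp add: telescope high)
  finally show ?thesis by simp
qed

text \<open>The relations of all dimensions are collected by subset. The dimension of
  \<open>I\<close> is one less than its cardinality, whence the minus sign in front.\<close>

lemma euler_char_eq:
  "euler_char A B m =
    - (\<Sum>I\<in>Pow A. (-1) ^ card I * (if \<exists>b\<in>B. m = b + (\<Sum>a\<in>I. a) then 1 else 0))"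
proof -
  \<comment> \<open>The absolute value matters only for \<open>l = -1\<close>, that is, for the
    empty set.\<close>
  have sign: "(-1) ^ nat \<bar>l\<bar> = - ((-1) ^ card I :: int)" if "int (card I) = l + 1" for l and I :: "'a set"
  proof (cases "card I")
    case 0
    with that have "l = -1" by simp
    then show ?thesis using 0 by simp
  next
    case (Suc k)
    with that have "l = int k" by simp
    then show ?thesis using Suc by simp
  qed
  have "euler_char A B m = (\<Sum>l = -1..int (card A) - 1. \<Sum>I\<in>relations A B m l. - ((-1) ^ card I))"
    unfolding euler_char_eq_relations
  proof (rule sum.cong[OF refl])
    fix l
    have "(\<Sum>I\<in>relations A B m l. - ((-1) ^ card I)) = (\<Sum>I\<in>relations A B m l. (-1) ^ nat \<bar>l\<bar> :: int)"
      by (rule sum.cong) (auto simp: mem_relations sign)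
    then show "(-1) ^ nat \<bar>l\<bar> * int (card (relations A B m l)) =
        (\<Sum>I\<in>relations A B m l. - ((-1) ^ card I))" by simp
  qed
  also have "\<dots> = (\<Sum>(l, I)\<in>(SIGMA l:{-1..int (card A) - 1}. relations A B m l). - ((-1) ^ card I))"
    by (rule sum.Sigma) (auto intro: finite_relations finite_A)
  also have "\<dots> = (\<Sum>I\<in>{I \<in> Pow A. \<exists>b\<in>B. m = b + (\<Sum>a\<in>I. a)}. - ((-1) ^ card I))"
    by (intro sum.reindex_bij_witness[where i = "\<lambda>I. (int (card I) - 1, I)" and j = snd])
      (auto simp: mem_relations dest: card_mono[OF finite_A])
  also have "\<dots> = (\<Sum>I\<in>Pow A. if \<exists>b\<in>B. m = b + (\<Sum>a\<in>I. a) then - ((-1) ^ card I) else 0)"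
    using finite_A by (simp only: sum.inter_filter finite_Pow_iff)
  also have "\<dots> = - (\<Sum>I\<in>Pow A. (-1) ^ card I * (if \<exists>b\<in>B. m = b + (\<Sum>a\<in>I. a) then 1 else 0))"
    unfolding sum_negf[symmetric] by (rule sum.cong) auto
  finally show ?thesis .
qed

end

text \<open>The minus sign of \<open>euler_char_eq\<close> cancels the one in \<open>PG\<close>, so
  the numerator is \<open>Nser B\<close> times the product over \<open>A\<close>, which then cancels
  against the denominator.\<close>

lemma PG_eq:
  fixes E A B :: "'a::fg_positive_cancel_semigroup set"
  assumes E: "0 \<notin> E" and A: "finite A" "0 \<notin> A"
    and B: "\<And>b n n'. b \<in> B \<Longrightarrow> b + n + n' \<in> B \<Longrightarrow> b + n \<in> B \<and> b + n' \<in> B"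
  shows "PG E A B = Nser B / (\<Prod>e\<in>E. 1 - tpow e)"
proof -
  have numerator: "- Series (\<lambda>m. euler_char A B m) = (\<Prod>a\<in>A. 1 - tpow a) * Nser B"
  proof (rule mseries_eqI)
    fix m
    interpret colored_graph A B m by (rule colored_graph.intro[OF A(1) B])
    show "coeff (- Series (\<lambda>m. euler_char A B m)) m = coeff ((\<Prod>a\<in>A. 1 - tpow a) * Nser B) m"
      by (simp add: euler_char_eq coeff_prod_one_minus_tpow_mult_Nser[OF A(1)])
  qed
  have "(\<Prod>e\<in>E. 1 - tpow e) * (\<Prod>a\<in>A. 1 - tpow a) dvd (1::'a mseries) * 1"
    using E A(2) by (intro mult_dvd_mono prod_one_minus_tpow_dvd_1)
  then have unit: "(\<Prod>e\<in>E. 1 - tpow e) * (\<Prod>a\<in>A. 1 - tpow a) dvd (1::'a mseries)" by simp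
  define q where "q = Nser B / (\<Prod>e\<in>E. 1 - tpow e)"
  then have q: "Nser B = q * (\<Prod>e\<in>E. 1 - tpow e)"
    using mseries_divide_eq_iff[OF prod_one_minus_tpow_dvd_1[OF E]] by blast
  have "PG E A B = q"
    unfolding PG_def mseries_divide_eq_iff[OF unit] numerator by (subst q) (simp add: ac_simps)
  then show ?thesis by (simp only: q_def)
qed


section \<open>Decomposition of the Poincare series\<close>

text \<open>This is the expansion of (1 - 1)^#s, with 0^0 = 1 for empty \<open>s\<close>.\<close>

lemma sum_Pow_minus_one_power_card:
  assumes "finite s"
  shows "(\<Sum>J\<in>Pow s. (-1) ^ card J) = (if s = {} then 1 else 0 :: int)"
  using prod_diff_conv_sum[OF assms, of "\<lambda>_. 1" "\<lambda>_. 1 :: int"] assms by (cases "s = {}") (simp_all add: power_0_left)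

section \<open>The sets attached to \<open>E\<close>\<close>

lemma mem_supp: "e \<in> supp E m \<longleftrightarrow> e \<in> E \<and> (\<exists>b. m = b + e)"
  using diff_emb_minus_in_iff[of m e UNIV] by (simp add: supp_def)

lemma mem_Qset: "m \<in> Qset E \<longleftrightarrow> supp E m = {}"
  by (auto simp: Qset_def supp_def)

lemma mem_Dset: "m \<in> Dset E J \<longleftrightarrow> J \<subseteq> supp E m \<and> \<not> (\<exists>b. m = b + (\<Sum>e\<in>J. e))"
  using diff_emb_minus_in_iff[of m "\<Sum>e\<in>J. e" UNIV] by (simp add: Dset_def)

lemma supp_add_mono: "supp E m \<subseteq> supp E (m + n)"
proof
  fix e assume "e \<in> supp E m"
  then obtain b where "e \<in> E" "m = b + e" by (auto simp: mem_supp)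
  then have "e \<in> E" "m + n = (b + n) + e" by (simp_all add: ac_simps)
  then show "e \<in> supp E (m + n)" unfolding mem_supp by blast
qed

text \<open>Supports grow under addition, so summands of an element with empty support have empty
  support.\<close>

lemma Qset_interval_closed:
  assumes "b + n + n' \<in> Qset E"
  shows "b + n \<in> Qset E \<and> b + n' \<in> Qset E"
  using assms supp_add_mono[of E "b + n" n'] supp_add_mono[of E "b + n'" n]
  by (auto simp: mem_Qset add.assoc add.commute[of n n'])

text \<open>The two conditions pass in opposite directions: J \<subseteq> supp m is inherited
  upwards from \<open>b\<close>, and m - e_J \<notin> S downwards from
  \<open>b + n + n'\<close>.\<close>

lemma Dset_interval_closed:
  assumes "b \<in> Dset E J" "b + n + n' \<in> Dset E J"
  shows "b + n \<in> Dset E J \<and> b + n' \<in> Dset E J"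
proof -
  have "b + k \<in> Dset E J" if "b + k + k' \<in> Dset E J" for k k'
  proof -
    have "\<not> (\<exists>c. b + k = c + (\<Sum>e\<in>J. e))"
    proof
      assume "\<exists>c. b + k = c + (\<Sum>e\<in>J. e)"
      then obtain c where "b + k = c + (\<Sum>e\<in>J. e)" ..
      then have "b + k + k' = (c + k') + (\<Sum>e\<in>J. e)" by (simp add: ac_simps)
      with that show False unfolding mem_Dset by blast
    qed
    then show ?thesis using assms(1) supp_add_mono[of E b k] by (auto simp: mem_Dset)
  qed
  from this[of n n'] this[of n' n] show ?thesis
    using assms(2) by (simp add: add.assoc add.commute[of n n'])
qed

text \<open>For e in J, the difference m - e is \<open>b\<close> plus the sum of the remaining
  elements of J. Hence only subsets of \<open>supp E m\<close> contribute to the coefficient of t^m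
  below.\<close>

lemma subset_supp_if_sum_diff:
  assumes "finite J" "J \<subseteq> E" "m = b + (\<Sum>e\<in>J. e)"
  shows "J \<subseteq> supp E m"
proof
  fix e assume e: "e \<in> J"
  then have "m = (b + (\<Sum>e\<in>J - {e}. e)) + e"
    using assms(1,3) by (simp add: sum.remove ac_simps)
  with e assms(2) show "e \<in> supp E m" unfolding mem_supp by blast
qed

lemma prod_one_minus_tpow_mult_Nser_UNIV:
  fixes E :: "'a::fg_positive_cancel_semigroup set"
  assumes E: "finite E"
  shows "(\<Prod>e\<in>E. 1 - tpow e) * Nser UNIV =
    Nser (Qset E) - (\<Sum>J | J \<subseteq> E \<and> card J \<ge> 2. (-1) ^ card J * Nser (Dset E J))"
proof (rule mseries_eqI)
  fix m
  define s where "s = supp E m"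
  define ind where "ind P = (if P then 1 else 0 :: int)" for P
  have s: "s \<subseteq> E" by (auto simp: s_def mem_supp)
  \<comment> \<open>For #J \<le> 1 the sum e_J is 0 or the single element of J, so J \<subseteq>
    supp m already gives m - e_J \<in> S, and D^J is empty. This is why the sum starts at #J =
    2.\<close>
  have small: "m \<notin> Dset E J" if "J \<subseteq> E" "\<not> card J \<ge> 2" for J
  proof -
    have "finite J" using that(1) E by (rule finite_subset)
    moreover from that(2) have "card J = 0 \<or> card J = 1" by linarith
    ultimately consider "J = {}" | e where "J = {e}" by (metis card_0_eq card_1_singletonE)
    then show ?thesis by cases (auto simp: mem_Dset mem_supp)
  qed
  \<comment> \<open>All J with m - e_J \<in> S are subsets of \<open>s\<close>, and the subsets of
    \<open>s\<close> that fail are exactly those with m \<in> D^J.\<close>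
  have split: "ind (\<exists>b. m = b + (\<Sum>e\<in>J. e)) = ind (J \<subseteq> s) - ind (m \<in> Dset E J)" if "J \<subseteq> E" for J
    using subset_supp_if_sum_diff[OF finite_subset[OF that E] that, of m]
    by (auto simp: ind_def mem_Dset s_def)
  have "coeff ((\<Prod>e\<in>E. 1 - tpow e) * Nser UNIV) m =
      (\<Sum>J\<in>Pow E. (-1) ^ card J * ind (\<exists>b. m = b + (\<Sum>e\<in>J. e)))"
    by (simp add: coeff_prod_one_minus_tpow_mult_Nser[OF E] ind_def)
  also have "\<dots> = (\<Sum>J\<in>Pow E. (-1) ^ card J * (ind (J \<subseteq> s) - ind (m \<in> Dset E J)))"
    by (rule sum.cong) (simp_all add: split)
  also have "\<dots> = (\<Sum>J\<in>Pow E. (-1) ^ card J * ind (J \<subseteq> s)) -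
      (\<Sum>J\<in>Pow E. (-1) ^ card J * ind (m \<in> Dset E J))"
    by (simp add: right_diff_distrib sum_subtractf)
  also have "(\<Sum>J\<in>Pow E. (-1) ^ card J * ind (J \<subseteq> s)) = (\<Sum>J\<in>Pow s. (-1) ^ card J)"
    using E s by (intro sum.mono_neutral_cong_right) (auto simp: ind_def)
  also have "\<dots> = ind (m \<in> Qset E)"
    using sum_Pow_minus_one_power_card[OF finite_subset[OF s E]]
    by (simp add: ind_def mem_Qset s_def)
  also have "(\<Sum>J\<in>Pow E. (-1) ^ card J * ind (m \<in> Dset E J)) =
      (\<Sum>J | J \<subseteq> E \<and> card J \<ge> 2. (-1) ^ card J * ind (m \<in> Dset E J))"
    using E small by (intro sum.mono_neutral_right) (auto simp: ind_def)
  finally show "coeff ((\<Prod>e\<in>E. 1 - tpow e) * Nser UNIV) m = coeff (Nser (Qset E) -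
      (\<Sum>J | J \<subseteq> E \<and> card J \<ge> 2. (-1) ^ card J * Nser (Dset E J))) m"
    by (simp add: coeff_sum coeff_minus_one_power_mult coeff_Nser ind_def)
qed

theorem theorem3p1:
  fixes E A :: "'a::fg_positive_cancel_semigroup set"
  assumes "finite E" and "E \<noteq> {}" and "0 \<notin> E"
    and "finite A" and "0 \<notin> A" and "A \<inter> E = {}"
  shows "(\<forall>B::'a set.
           (\<forall>b n n'. b \<in> B \<longrightarrow> b + n + n' \<in> B \<longrightarrow> b + n \<in> B \<and> b + n' \<in> B) \<longrightarrow>
             PG E A B = Nser B / (\<Prod>e\<in>E. 1 - tpow e) \<and>
             (\<forall>A'. finite A' \<longrightarrow> 0 \<notin> A' \<longrightarrow> A' \<inter> E = {} \<longrightarrow> PG E A' B = PG E A B)) \<and>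
         Nser (UNIV :: 'a set) =
           PG E A (Qset E) -
           (\<Sum>J | J \<subseteq> E \<and> card J \<ge> 2. (-1) ^ card J * PG E A (Dset E J))"
proof (intro conjI allI impI)
  fix B :: "'a set"
  assume B: "\<forall>b n n'. b \<in> B \<longrightarrow> b + n + n' \<in> B \<longrightarrow> b + n \<in> B \<and> b + n' \<in> B"
  show PG: "PG E A B = Nser B / (\<Prod>e\<in>E. 1 - tpow e)"
    by (rule PG_eq[OF assms(3-5)]) (use B in blast)
  fix A' :: "'a set" assume "finite A'" "0 \<notin> A'"
  then have "PG E A' B = Nser B / (\<Prod>e\<in>E. 1 - tpow e)"
    by (rule PG_eq[OF assms(3)]) (use B in blast)
  with PG show "PG E A' B = PG E A B" by simp
next
  let ?prod = "\<Prod>e\<in>E. 1 - tpow e :: 'a mseries"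
  have Q: "PG E A (Qset E) = Nser (Qset E) / ?prod"
    by (rule PG_eq[OF assms(3-5) Qset_interval_closed])
  have D: "PG E A (Dset E J) = Nser (Dset E J) / ?prod" for J
    by (rule PG_eq[OF assms(3-5) Dset_interval_closed])
  have "Nser UNIV = (Nser (Qset E) -
      (\<Sum>J | J \<subseteq> E \<and> card J \<ge> 2. (-1) ^ card J * Nser (Dset E J))) / ?prod"
    using mseries_divide_eq_iff[OF prod_one_minus_tpow_dvd_1[OF assms(3)]]
      prod_one_minus_tpow_mult_Nser_UNIV[OF assms(1)]
    by (metis mult.commute)
  then show "Nser UNIV = PG E A (Qset E) -
      (\<Sum>J | J \<subseteq> E \<and> card J \<ge> 2. (-1) ^ card J * PG E A (Dset E J))"
    by (simp add: Q D divide_mseries_def left_diff_distrib sum_distrib_right mult.assoc)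
qed

end
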